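(* Let $H_1,H_2$ be real Hilbert spaces (possibly infinite dimensional), let $g:H_1\to\mathbb{R}\cup\{\infty\}$ and $f:H_2\to\mathbb{R}\cup\{\infty\}$ be proper, convex and lower semicontinuous, let $L:H_1\to H_2$ be a bounded linear operator, and let $\lambda>0$. Assume that both the primal problem $(P)$ and the dual problem $(D)$ have optimal solutions and that at least one of the regularity conditions (R1), (R2) of the context holds. Suppose that $$\partial\bigl(g^*\circ(-L^* )\bigr)(b)=-L\,\partial g^*(-L^*b)\qquad\text{for all } b\in H_2,$$ that the approximate alternating split Bregman algorithm (with initial elements $b^0,d^0\in H_2$ and error tolerances $\alpha_k,\beta_k\ge0$, $k\ge1$) is well defined, and that $$\sum_{k=1}^{\infty}(\alpha_k+\beta_k)<\infty .$$ Let $\{u^k\}$, $\{d^k\}$, $\{b^k\}$ be three sequences generated by the approximate alternating split Bregman algorithm. Then $\{d^k\}$ and $\{b^k\}$ converge weakly in $H_2$ to some $\hat d$ and $\hat b$, respectively. Moreover, $\lambda\hat b$ is a solution of the dual problem $(D)$, the sequence $\{d^k-Lu^{k+1}\}$ converges strongly to zero, and $$\sum_{k=0}^{\infty}\|d^k-Lu^{k+1}\|^2<\infty .$$ Furthermore, $L^{-1}(\hat d)=\{u\in H_1: Lu=\hat d\}$ contains a solution $\hat u$ of the primal problem $(P)$. In particular, if $L$ is injective, then $\{u^k\}$ has at most one weak cluster point, and any such weak cluster point $\bar u$ satisfies $\bar u=\hat u$.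
   Context: Hilbert spaces are identified with their duals; $L^*:H_2\to H_1$ is the adjoint of $L$; $f^*,g^*$ denote the convex (Fenchel) conjugates; $\partial$ is the convex subdifferential; $\mathrm{dom}$ denotes the effective domain. Primal problem $(P)$: $\min_{u\in H_1}\{g(u)+f(Lu)\}$. Dual problem $(D)$: $-\min_{b\in H_2}\{g^*(-L^*b)+f^*(b)\}$; a solution of $(D)$ is a minimizer over $b\in H_2$ of $g^*(-L^*b)+f^*(b)$. Regularity conditions: (R1) there exists $x\in\mathrm{dom}(g)\cap\mathrm{dom}(f\circ L)$ such that $f$ is continuous at $Lx$; (R2) $0\in\mathrm{int}\,(L\,\mathrm{dom}(g)-\mathrm{dom}(f))$. Approximate alternating split Bregman algorithm: given $b^0,d^0\in H_2$ and $\alpha_k,\beta_k\ge0$, for $k\ge1$: (1) find $u^k\in H_1$ such that $\|Lu^k-Lu^k_{ex}\|\le\alpha_k$, where $u^k_{ex}$ is a minimizer over $H_1$ of $I_1^k(u)=g(u)+\frac{\lambda}{2}\|b^{k-1}+Lu-d^{k-1}\|^2$; (2) find $d^k\in H_2$ such that $\|d^k-d^k_{ex}\|\le\beta_k$, where $d^k_{ex}$ is the minimizer over $H_2$ of $I_2^k(d)=f(d)+\frac{\lambda}{2}\|b^{k-1}+Lu^k-d\|^2$; (3) set $b^k=b^{k-1}+Lu^k-d^k$. The algorithm is said to be well defined if for all $k\ge1$ the functionals $I_1^k$ and $I_2^k$ have minimizers in $H_1$ and $H_2$, respectively. *)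

theory Defs
  imports "HOL-Analysis.Analysis"
begin

text \<open>
  Functions with values in \<open>\<real> \<union> {\<infinity>}\<close> are \<^typ>\<open>ereal\<close>-valued functions that never take the
  value \<open>-\<infinity>\<close>; the latter requirement is part of \<open>proper\<close>.
\<close>

definition effective_domain :: "('a \<Rightarrow> ereal) \<Rightarrow> 'a set" where
  "effective_domain F = {x. F x < \<infinity>}"

definition proper :: "('a \<Rightarrow> ereal) \<Rightarrow> bool" where
  "proper F \<longleftrightarrow> (\<forall>x. F x \<noteq> -\<infinity>) \<and> effective_domain F \<noteq> {}"

definition convex_fun :: "('a::real_vector \<Rightarrow> ereal) \<Rightarrow> bool" where
  "convex_fun F \<longleftrightarrow>
     (\<forall>x y t. 0 < t \<and> t < 1 \<longrightarrow>
        F ((1 - t) *\<^sub>R x + t *\<^sub>R y) \<le> ereal (1 - t) * F x + ereal t * F y)"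

definition lower_semicontinuous :: "('a::topological_space \<Rightarrow> ereal) \<Rightarrow> bool" where
  "lower_semicontinuous F \<longleftrightarrow> (\<forall>x. F x \<le> Liminf (at x) F)"

definition conjugate :: "('a::real_inner \<Rightarrow> ereal) \<Rightarrow> 'a \<Rightarrow> ereal" where
  "conjugate F p = (SUP x. ereal (p \<bullet> x) - F x)"

text \<open>By convention, the subdifferential is empty where the function is not finite.\<close>

definition subdifferential :: "('a::real_inner \<Rightarrow> ereal) \<Rightarrow> 'a \<Rightarrow> 'a set" where
  "subdifferential F x =
     {p. \<bar>F x\<bar> \<noteq> \<infinity> \<and> (\<forall>y. F x + ereal (p \<bullet> (y - x)) \<le> F y)}"

abbreviation minimizer :: "('a \<Rightarrow> ereal) \<Rightarrow> 'a \<Rightarrow> bool" where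
  "minimizer F \<equiv> is_arg_min F (\<lambda>_. True)"

text \<open>
  The coarsest topology for which all continuous linear functionals are continuous. Weak
  convergence is \<^const>\<open>limitin\<close> for this topology; weak cluster points are cluster points in the
  topological sense, which include all weak limits of subsequences.
\<close>

definition weak_topology :: "'a::real_normed_vector topology" where
  "weak_topology =
     topology_generated_by {\<phi> -` V | (\<phi> :: 'a \<Rightarrow> real) V. bounded_linear \<phi> \<and> open V}"

definition weak_cluster_point :: "(nat \<Rightarrow> 'a::real_normed_vector) \<Rightarrow> 'a \<Rightarrow> bool" where
  "weak_cluster_point x l \<longleftrightarrow>
     (\<forall>U. openin weak_topology U \<and> l \<in> U \<longrightarrow> (\<exists>\<^sub>F k in sequentially. x k \<in> U))"

definition primal_objective ::
  "('b \<Rightarrow> ereal) \<Rightarrow> ('a \<Rightarrow> ereal) \<Rightarrow> ('a \<Rightarrow> 'b) \<Rightarrow> 'a \<Rightarrow> ereal" where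
  "primal_objective f g L u = g u + f (L u)"

text \<open>
  The constant \<^const>\<open>adjoint\<close> of the library is specified by choice; for bounded linear operators
  between Hilbert spaces the adjoint exists and is unique, so it is the Hilbert space adjoint.
\<close>

definition dual_objective ::
  "('b::real_inner \<Rightarrow> ereal) \<Rightarrow> ('a::real_inner \<Rightarrow> ereal) \<Rightarrow> ('a \<Rightarrow> 'b) \<Rightarrow> 'b \<Rightarrow> ereal" where
  "dual_objective f g L b = conjugate g (- adjoint L b) + conjugate f b"

definition regularity1 ::
  "('b::t2_space \<Rightarrow> ereal) \<Rightarrow> ('a \<Rightarrow> ereal) \<Rightarrow> ('a \<Rightarrow> 'b) \<Rightarrow> bool" where
  "regularity1 f g L \<longleftrightarrow>
     (\<exists>x \<in> effective_domain g \<inter> effective_domain (f \<circ> L). isCont f (L x))"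

definition regularity2 ::
  "('b::real_normed_vector \<Rightarrow> ereal) \<Rightarrow> ('a \<Rightarrow> ereal) \<Rightarrow> ('a \<Rightarrow> 'b) \<Rightarrow> bool" where
  "regularity2 f g L \<longleftrightarrow>
     0 \<in> interior {L x - y | x y. x \<in> effective_domain g \<and> y \<in> effective_domain f}"

text \<open>
  The functionals minimized in the two steps of an iteration; \<open>b\<close> and \<open>d\<close> are the iterates of the
  previous iteration, and \<open>u\<close> in the second functional is the new iterate.
\<close>

definition asb_functional1 ::
  "('a \<Rightarrow> ereal) \<Rightarrow> ('a \<Rightarrow> 'b::real_normed_vector) \<Rightarrow> real \<Rightarrow> 'b \<Rightarrow> 'b \<Rightarrow> 'a \<Rightarrow> ereal" where
  "asb_functional1 g L lam b d = (\<lambda>u. g u + ereal (lam / 2 * (norm (b + L u - d))\<^sup>2))"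

definition asb_functional2 ::
  "('b::real_normed_vector \<Rightarrow> ereal) \<Rightarrow> ('a \<Rightarrow> 'b) \<Rightarrow> real \<Rightarrow> 'b \<Rightarrow> 'a \<Rightarrow> 'b \<Rightarrow> ereal" where
  "asb_functional2 f L lam b u = (\<lambda>d. f d + ereal (lam / 2 * (norm (b + L u - d))\<^sup>2))"

text \<open>The algorithm does not assign a value to \<open>u 0\<close>, which remains arbitrary here.\<close>

definition asb_generated ::
  "('b::real_normed_vector \<Rightarrow> ereal) \<Rightarrow> ('a \<Rightarrow> ereal) \<Rightarrow> ('a \<Rightarrow> 'b) \<Rightarrow> real \<Rightarrow>
   (nat \<Rightarrow> real) \<Rightarrow> (nat \<Rightarrow> real) \<Rightarrow> 'b \<Rightarrow> 'b \<Rightarrow>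
   (nat \<Rightarrow> 'a) \<Rightarrow> (nat \<Rightarrow> 'b) \<Rightarrow> (nat \<Rightarrow> 'b) \<Rightarrow> bool" where
  "asb_generated f g L lam \<alpha> \<beta> b0 d0 u d b \<longleftrightarrow>
     b 0 = b0 \<and> d 0 = d0 \<and>
     (\<forall>k\<ge>1.
        (\<exists>uex. minimizer (asb_functional1 g L lam (b (k - 1)) (d (k - 1))) uex \<and>
               norm (L (u k) - L uex) \<le> \<alpha> k) \<and>
        (\<exists>dex. minimizer (asb_functional2 f L lam (b (k - 1)) (u k)) dex \<and>
               norm (d k - dex) \<le> \<beta> k) \<and>
        b k = b (k - 1) + L (u k) - d k)"

text \<open>
  Since the functionals depend on the iterates, well-definedness is a property of the run
  \<open>(u, d, b)\<close> of the algorithm.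
\<close>

definition asb_well_defined ::
  "('b::real_normed_vector \<Rightarrow> ereal) \<Rightarrow> ('a \<Rightarrow> ereal) \<Rightarrow> ('a \<Rightarrow> 'b) \<Rightarrow> real \<Rightarrow>
   (nat \<Rightarrow> 'a) \<Rightarrow> (nat \<Rightarrow> 'b) \<Rightarrow> (nat \<Rightarrow> 'b) \<Rightarrow> bool" where
  "asb_well_defined f g L lam u d b \<longleftrightarrow>
     (\<forall>k\<ge>1.
        (\<exists>v. minimizer (asb_functional1 g L lam (b (k - 1)) (d (k - 1))) v) \<and>
        (\<exists>e. minimizer (asb_functional2 f L lam (b (k - 1)) (u k)) e))"

end

theory Submission
  imports Defs "HOL-Complex_Analysis.Great_Picard"
begin

text \<open>
  The algorithm is a Douglas-Rachford iteration for the two monotone operators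
  \<open>\<partial>(g\<^sup>* \<circ> (-L\<^sup>*))\<close> and \<open>\<partial>f\<^sup>*\<close>, and its convergence is a Fejer argument for the \<^emph>\<open>pair\<close> of
  sequences \<open>(b\<^sup>k, d\<^sup>k)\<close>. The limits are to be found among the points \<open>(p/\<lambda>, L v)\<close>, where
  \<open>(v, p)\<close> satisfies \<open>-L\<^sup>* p \<in> \<partial>g(v)\<close> and \<open>p \<in> \<partial>f(L v)\<close> (\<open>KKT_pair\<close>); for such a pair \<open>v\<close> solves
  the primal and \<open>p\<close> the dual problem.

  \<^bold>\<open>Existence of a pair.\<close> Both regularity conditions imply that the perturbed problem
  \<open>inf\<^sub>x (g x + f (L x + y))\<close> is feasible for all small \<open>y\<close>. The sets of those \<open>y\<close> for which some \<open>x\<close>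
  in a ball does it with values below a bound are convex and, by weak compactness of balls, closed,
  so Baire's theorem bounds the perturbation function near \<open>0\<close>
  (\<open>perturbation_bounded_near_0\<close>). A convex function bounded near \<open>0\<close> has a subgradient there, and
  this is the multiplier \<open>p\<close> belonging to a primal solution (\<open>ex_KKT_multiplier\<close>).

  \<^bold>\<open>Decrease.\<close> Let \<open>c\<^sup>k\<close> be the exact minimizer in the second step and \<open>s\<^sup>k = b\<^sup>k + (d\<^sup>k - c\<^sup>k)\<close>. The
  optimality conditions read \<open>\<lambda>s\<^sup>k \<in> \<partial>f(c\<^sup>k)\<close> and, with \<open>a = L u\<^bsub>ex\<^esub>\<close> for the exact minimizer in the
  first step of the next iteration, \<open>-L\<^sup>* \<lambda>\<pi> \<in> \<partial>g(u\<^bsub>ex\<^esub>)\<close> for \<open>\<pi> = b\<^sup>k - d\<^sup>k + a\<close>. Without errors,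
  monotonicity of the two subdifferentials gives
  \<open>|b\<^sup>k\<^sup>+\<^sup>1 - b\<^sup>*|\<^sup>2 + |d\<^sup>k\<^sup>+\<^sup>1 - d\<^sup>*|\<^sup>2 \<le> |b\<^sup>k - b\<^sup>*|\<^sup>2 + |d\<^sup>k - d\<^sup>*|\<^sup>2 - |d\<^sup>k - a|\<^sup>2\<close>
  for every limit candidate \<open>(b\<^sup>*, d\<^sup>*)\<close>. With errors, \<open>(s\<^sup>k, c\<^sup>k)\<close> obeys the same estimate up to summable
  perturbations (\<open>Douglas_Rachford_step\<close>, \<open>quasi_Fejer_convergence\<close>). So distances to the candidates
  converge and \<open>|c\<^sup>k - a|\<^sup>2\<close> is summable.

  \<^bold>\<open>Weak limits.\<close> If \<open>\<pi> - s\<^sup>k\<close> and \<open>c\<^sup>k - a\<close> tend to \<open>0\<close>, the Fenchel-Young equalities of the two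
  optimality conditions add up to something that tends to \<open>0\<close>, while conjugates are suprema of
  affine functions and hence weakly lower semicontinuous. In the limit the sum of the Fenchel-Young
  gaps is not positive, so both gaps vanish; the chain rule for
  \<open>\<partial>(g\<^sup>* \<circ> (-L\<^sup>*))\<close> and the Fenchel-Moreau theorem turn this into a \<open>KKT_pair\<close>
  (\<open>KKT_demiclosed\<close>). Thus all weak cluster points of \<open>(s\<^sup>k, c\<^sup>k)\<close> are candidates, and Opial's lemma
  (\<open>Opial_weak_lim\<close>), applied in the product space, gives weak convergence.
\<close>

section \<open>Projections and the Riesz representation in Hilbert spaces\<close>

text \<open>
  By the parallelogram law a minimizing sequence for the distance from \<open>a\<close> to \<open>S\<close> is a Cauchy
  sequence. Its limit \<open>x\<close> is the nearest point; the variational inequality, which is what separation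
  arguments use, compares \<open>x\<close> with points of \<open>S\<close> on segments starting at \<open>x\<close>.
\<close>
lemma ex_nearest_point_variational:
  fixes a :: "'a::{real_inner, complete_space}"
  assumes "closed S" "convex S" "S \<noteq> {}"
  obtains x where "x \<in> S" "\<And>y. y \<in> S \<Longrightarrow> (a - x) \<bullet> (y - x) \<le> 0"
proof -
  define D where "D = infdist a S"
  have D_le: "D \<le> norm (a - y)" if "y \<in> S" for y
    using infdist_le[OF that, of a] by (simp add: D_def dist_norm)
  have D0: "D \<ge> 0" by (simp add: D_def infdist_nonneg)
  have "\<exists>y\<in>S. dist a y < D + e" if "e > 0" for e
    using cInf_lessD[of "dist a ` S" "D + e"] assms(3) that
    by (auto simp: D_def infdist_def)
  then have "\<exists>y\<in>S. norm (a - y) < D + inverse (Suc n)" for n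
    by (simp add: dist_norm)
  then obtain s where sS: "\<And>n. s n \<in> S"
    and s: "\<And>n. norm (a - s n) < D + inverse (Suc n)"
    by metis
  have s_lim: "(\<lambda>n. norm (a - s n)) \<longlonglongrightarrow> D"
  proof (rule tendsto_sandwich[of "\<lambda>n. D" _ _ "\<lambda>n. D + inverse (Suc n)"])
    show "(\<lambda>n. D + inverse (real (Suc n))) \<longlonglongrightarrow> D"
      using tendsto_add[OF tendsto_const LIMSEQ_inverse_real_of_nat, of D] by simp
  qed (use s D_le sS in \<open>auto intro!: always_eventually less_imp_le\<close>)
  have para: "(norm (x - y))\<^sup>2 \<le> 2 * (norm (a - x))\<^sup>2 + 2 * (norm (a - y))\<^sup>2 - 4 * D\<^sup>2"
    if "x \<in> S" "y \<in> S" for x y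
  proof -
    have "(1/2) *\<^sub>R x + (1/2) *\<^sub>R y \<in> S"
      using convexD[OF assms(2) that, of "1/2" "1/2"] by simp
    then have "D\<^sup>2 \<le> (norm (a - ((1/2) *\<^sub>R x + (1/2) *\<^sub>R y)))\<^sup>2"
      using D_le D0 by (intro power_mono) auto
    moreover have "(norm (x - y))\<^sup>2 = 2 * (norm (a - x))\<^sup>2 + 2 * (norm (a - y))\<^sup>2
        - 4 * (norm (a - ((1/2) *\<^sub>R x + (1/2) *\<^sub>R y)))\<^sup>2"
      by (simp add: power2_norm_eq_inner algebra_simps inner_commute)
    ultimately show ?thesis by simp
  qed
  have "Cauchy s"
  proof (rule metric_CauchyI)
    fix e :: real assume e: "e > 0"
    have "(\<lambda>n. (norm (a - s n))\<^sup>2) \<longlonglongrightarrow> D\<^sup>2"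
      using s_lim by (intro tendsto_intros)
    then have "eventually (\<lambda>n. (norm (a - s n))\<^sup>2 < D\<^sup>2 + e\<^sup>2 / 4) sequentially"
      using e by (intro order_tendstoD(2)) auto
    then obtain N where N: "\<And>n. n \<ge> N \<Longrightarrow> (norm (a - s n))\<^sup>2 < D\<^sup>2 + e\<^sup>2 / 4"
      by (auto simp: eventually_sequentially)
    show "\<exists>M. \<forall>m\<ge>M. \<forall>n\<ge>M. dist (s m) (s n) < e"
    proof (intro exI allI impI)
      fix m n assume "N \<le> m" "N \<le> n"
      then have "(norm (s m - s n))\<^sup>2 < e\<^sup>2"
        using para[OF sS sS, of m n] N[of m] N[of n] by (simp add: field_simps)
      then show "dist (s m) (s n) < e"
        using e by (simp add: dist_norm power2_less_imp_less)
    qed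
  qed
  then obtain x where x: "s \<longlonglongrightarrow> x"
    using Cauchy_convergent convergent_def by blast
  have xS: "x \<in> S" using assms(1) sS x closed_sequentially by blast
  have "(\<lambda>n. norm (a - s n)) \<longlonglongrightarrow> norm (a - x)"
    using x by (intro tendsto_intros)
  then have xD: "norm (a - x) = D" using s_lim LIMSEQ_unique by blast
  have "(a - x) \<bullet> (y - x) \<le> 0" if "y \<in> S" for y
  proof (rule ccontr)
    assume c: "\<not> ?thesis"
    define i where "i = (a - x) \<bullet> (y - x)"
    define q where "q = (norm (y - x))\<^sup>2"
    have i: "i > 0" using c i_def by simp
    have q: "q > 0" using c by (auto simp: q_def)
    define t where "t = min 1 (i / q)"
    have t: "0 < t" "t \<le> 1" "t * q \<le> i"
      using i q by (auto simp: t_def min_def field_simps)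
    have "(1 - t) *\<^sub>R x + t *\<^sub>R y \<in> S"
      using convexD[OF assms(2) xS that, of "1 - t" t] t by simp
    then have "D\<^sup>2 \<le> (norm (a - ((1 - t) *\<^sub>R x + t *\<^sub>R y)))\<^sup>2"
      using D_le D0 by (intro power_mono) auto
    also have "a - ((1 - t) *\<^sub>R x + t *\<^sub>R y) = (a - x) - t *\<^sub>R (y - x)"
      by (simp add: algebra_simps)
    also have "(norm \<dots>)\<^sup>2 = (norm (a - x))\<^sup>2 - 2 * t * i + t * (t * q)"
      unfolding i_def q_def power2_norm_eq_inner
      by (simp add: algebra_simps inner_commute)
    finally have "2 * i \<le> t * q" using t(1) xD by simp
    then show False using t(3) i by simp
  qed
  with xS that show ?thesis by blast
qed

lemma nearest_point_subspace_orthogonal: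
  fixes M :: "'a::{real_inner, complete_space} set"
  assumes "closed M" "subspace M"
  obtains m where "m \<in> M" "\<And>z. z \<in> M \<Longrightarrow> (y - m) \<bullet> z = 0"
proof -
  obtain m where m: "m \<in> M" "\<And>z. z \<in> M \<Longrightarrow> (y - m) \<bullet> (z - m) \<le> 0"
    using ex_nearest_point_variational[of M y] assms subspace_imp_convex subspace_0 by blast
  have "(y - m) \<bullet> z = 0" if "z \<in> M" for z
    using m(2)[of "m + z"] m(2)[of "m - z"] m(1) that assms(2)
    by (simp add: subspace_add subspace_diff)
  with m(1) that show ?thesis by blast
qed

text \<open>
  The representing vector spans the orthogonal complement of the kernel.
\<close>
lemma Riesz_representation:
  fixes \<phi> :: "'a::{real_inner, complete_space} \<Rightarrow> real"
  assumes "bounded_linear \<phi>"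
  obtains l where "\<And>x. \<phi> x = l \<bullet> x"
proof (cases "\<forall>x. \<phi> x = 0")
  case True
  then show ?thesis using that[of 0] by simp
next
  case False
  interpret bounded_linear \<phi> by fact
  obtain v where v: "\<phi> v \<noteq> 0" using False by blast
  define M where "M = {x. \<phi> x = 0}"
  have "closed M"
    unfolding M_def by (intro closed_Collect_eq continuous_intros continuous_on assms)
  moreover have "subspace M"
    by (auto simp: M_def subspace_def add scaleR zero)
  ultimately obtain m where m: "m \<in> M" "\<And>z. z \<in> M \<Longrightarrow> (v - m) \<bullet> z = 0"
    using nearest_point_subspace_orthogonal by blast
  define w where "w = v - m"
  have pw: "\<phi> w = \<phi> v" using m(1) by (simp add: w_def diff M_def)
  have w0: "w \<bullet> w \<noteq> 0" using pw v zero by auto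
  show ?thesis
  proof (rule that[of "(\<phi> w / (w \<bullet> w)) *\<^sub>R w"])
    fix x
    have "\<phi> (x - (\<phi> x / \<phi> w) *\<^sub>R w) = 0"
      using pw v by (simp add: diff scaleR)
    then have "w \<bullet> (x - (\<phi> x / \<phi> w) *\<^sub>R w) = 0"
      using m(2) by (simp add: M_def w_def)
    then have "w \<bullet> x = (\<phi> x / \<phi> w) * (w \<bullet> w)" by (simp add: inner_diff_right)
    then show "\<phi> x = (\<phi> w / (w \<bullet> w)) *\<^sub>R w \<bullet> x"
      using w0 v pw by (simp add: field_simps)
  qed
qed

text \<open>
  Without this existence result the choice in \<^const>\<open>adjoint\<close> would say nothing.
\<close>
lemma adjoint_Hilbert:
  fixes L :: "'a::{real_inner, complete_space} \<Rightarrow> 'b::real_inner"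
  assumes "bounded_linear L"
  shows "L x \<bullet> y = x \<bullet> adjoint L y"
proof -
  have "\<exists>l. \<forall>x. L x \<bullet> y = x \<bullet> l" for y
  proof -
    have "bounded_linear (\<lambda>x. L x \<bullet> y)"
      using bounded_linear_compose[OF bounded_linear_inner_left assms] .
    then show ?thesis using Riesz_representation by (metis inner_commute)
  qed
  then have "\<exists>f'. \<forall>x y. L x \<bullet> y = x \<bullet> f' y" by metis
  then have "\<forall>x y. L x \<bullet> y = x \<bullet> adjoint L y"
    unfolding adjoint_def by (rule someI_ex)
  then show ?thesis by blast
qed

lemma inner_adjoint_Hilbert:
  fixes L :: "'a::{real_inner, complete_space} \<Rightarrow> 'b::real_inner"
  assumes "bounded_linear L"
  shows "adjoint L y \<bullet> x = y \<bullet> L x"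
  using adjoint_Hilbert[OF assms, of x y] by (simp add: inner_commute)

section \<open>Weak convergence\<close>

text \<open>
  By the Riesz representation this is sequential convergence in \<^const>\<open>weak_topology\<close> for complete
  spaces; the inner product form is the one that estimates use.
\<close>
definition weak_lim :: "(nat \<Rightarrow> 'a::real_inner) \<Rightarrow> 'a \<Rightarrow> bool" where
  "weak_lim x l \<longleftrightarrow> (\<forall>y. (\<lambda>n. x n \<bullet> y) \<longlonglongrightarrow> l \<bullet> y)"

lemma weak_limD: "weak_lim x l \<Longrightarrow> (\<lambda>n. x n \<bullet> y) \<longlonglongrightarrow> l \<bullet> y"
  and weak_limD': "weak_lim x l \<Longrightarrow> (\<lambda>n. y \<bullet> x n) \<longlonglongrightarrow> y \<bullet> l"
  by (auto simp: weak_lim_def inner_commute)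

lemma tendsto_imp_weak_lim: "x \<longlonglongrightarrow> l \<Longrightarrow> weak_lim x l"
  unfolding weak_lim_def by (auto intro!: tendsto_intros)

lemma weak_lim_add: "weak_lim x l \<Longrightarrow> weak_lim y m \<Longrightarrow> weak_lim (\<lambda>n. x n + y n) (l + m)"
  unfolding weak_lim_def by (auto simp: inner_add_left intro: tendsto_add)

lemma weak_lim_scaleR: "weak_lim x l \<Longrightarrow> weak_lim (\<lambda>n. c *\<^sub>R x n) (c *\<^sub>R l)"
  unfolding weak_lim_def by (auto intro: tendsto_mult_left)

lemma weak_lim_subseq: "weak_lim x l \<Longrightarrow> strict_mono r \<Longrightarrow> weak_lim (\<lambda>n. x (r n)) l"
  unfolding weak_lim_def using LIMSEQ_subseq_LIMSEQ[of _ _ r] by (auto simp: o_def)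

lemma weak_lim_Suc_iff: "weak_lim (\<lambda>n. x (Suc n)) l \<longleftrightarrow> weak_lim x l"
  unfolding weak_lim_def
  using filterlim_sequentially_Suc[of "\<lambda>n. x n \<bullet> y" "nhds (l \<bullet> y)" for y] by simp

lemma weak_lim_bounded_linear:
  fixes L :: "'a::{real_inner, complete_space} \<Rightarrow> 'b::real_inner"
  assumes "bounded_linear L" "weak_lim x l"
  shows "weak_lim (\<lambda>n. L (x n)) (L l)"
  using assms by (simp add: weak_lim_def adjoint_Hilbert)

lemma weak_lim_Pair_iff:
  "weak_lim x (l :: 'a::real_inner \<times> 'b::real_inner) \<longleftrightarrow>
     weak_lim (\<lambda>n. fst (x n)) (fst l) \<and> weak_lim (\<lambda>n. snd (x n)) (snd l)"
proof
  assume *: "weak_lim x l"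
  show "weak_lim (\<lambda>n. fst (x n)) (fst l) \<and> weak_lim (\<lambda>n. snd (x n)) (snd l)"
    unfolding weak_lim_def
  proof (intro conjI allI)
    fix y :: 'a show "(\<lambda>n. fst (x n) \<bullet> y) \<longlonglongrightarrow> fst l \<bullet> y"
      using weak_limD[OF *, of "(y, 0)"] by (simp add: inner_prod_def)
  next
    fix y :: 'b show "(\<lambda>n. snd (x n) \<bullet> y) \<longlonglongrightarrow> snd l \<bullet> y"
      using weak_limD[OF *, of "(0, y)"] by (simp add: inner_prod_def)
  qed
next
  assume "weak_lim (\<lambda>n. fst (x n)) (fst l) \<and> weak_lim (\<lambda>n. snd (x n)) (snd l)"
  then show "weak_lim x l"
    by (auto simp: weak_lim_def inner_prod_def intro!: tendsto_add)
qed

text \<open>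
  A diagonal subsequence makes the inner products with every \<open>x m\<close> converge. The vectors against which it converges form a closed subspace, so it contains the
  closed span of the sequence, and a vector orthogonal to that span contributes only zeros. The limit
  functional is bounded and so has a representing vector.
\<close>
lemma bounded_imp_weak_lim_subseq:
  fixes x :: "nat \<Rightarrow> 'a::{real_inner, complete_space}"
  assumes "bounded (range x)"
  obtains r l where "strict_mono r" "weak_lim (\<lambda>n. x (r n)) l"
proof -
  obtain B where B: "B > 0" "\<And>n. norm (x n) \<le> B"
    using assms by (auto simp: bounded_pos)
  have "norm (x n \<bullet> x m) \<le> B * B" for n m
    using Cauchy_Schwarz_ineq2[of "x n" "x m"] mult_mono[OF B(2)[of n] B(2)[of m]] B(1)
    by simp
  then obtain r where r: "strict_mono (r :: nat \<Rightarrow> nat)"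
    and rl: "\<And>m. \<exists>l. (\<lambda>n. x (r n) \<bullet> x m) \<longlonglongrightarrow> l"
    using function_convergent_subsequence[of "UNIV :: nat set" "\<lambda>n m. x n \<bullet> x m" "B * B"]
    by (metis UNIV_I uncountable_def countableI_type)
  define M where "M = {y. convergent (\<lambda>n. x (r n) \<bullet> y)}"
  have sub: "subspace M"
    unfolding subspace_def M_def convergent_def
    by (auto simp: inner_add_right intro: tendsto_add tendsto_mult_left)
  have clo: "closed M"
    unfolding closed_sequential_limits
  proof (intro allI impI, elim conjE)
    fix y l assume y: "\<forall>n. y n \<in> M" and yl: "y \<longlonglongrightarrow> l"
    show "l \<in> M"
      unfolding M_def mem_Collect_eq Cauchy_convergent_iff[symmetric]
    proof (rule metric_CauchyI)
      fix e :: real assume e: "e > 0"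
      obtain k where k: "norm (y k - l) < e / (3 * B)"
        using LIMSEQ_D[OF yl, of "e / (3 * B)"] e B(1) by auto
      have "Cauchy (\<lambda>n. x (r n) \<bullet> y k)"
        using y by (simp add: M_def Cauchy_convergent_iff)
      then obtain N where N: "\<And>m n. m \<ge> N \<Longrightarrow> n \<ge> N \<Longrightarrow>
          dist (x (r m) \<bullet> y k) (x (r n) \<bullet> y k) < e / 3"
        using metric_CauchyD[of _ "e / 3"] e by force
      have near: "\<bar>x n \<bullet> l - x n \<bullet> y k\<bar> \<le> e / 3" for n
      proof -
        have "\<bar>x n \<bullet> l - x n \<bullet> y k\<bar> = \<bar>x n \<bullet> (y k - l)\<bar>"
          by (simp add: inner_diff_right)
        also have "\<dots> \<le> norm (x n) * norm (y k - l)" by (rule Cauchy_Schwarz_ineq2)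
        also have "\<dots> \<le> B * (e / (3 * B))"
          using B k by (intro mult_mono) auto
        also have "\<dots> = e / 3" using B(1) by simp
        finally show ?thesis .
      qed
      show "\<exists>N. \<forall>m\<ge>N. \<forall>n\<ge>N. dist (x (r m) \<bullet> l) (x (r n) \<bullet> l) < e"
      proof (intro exI allI impI)
        fix m n assume "N \<le> m" "N \<le> n"
        from N[OF this] near[of "r m"] near[of "r n"]
        show "dist (x (r m) \<bullet> l) (x (r n) \<bullet> l) < e"
          unfolding dist_real_def by linarith
      qed
    qed
  qed
  have xM: "x n \<in> M" for n using rl by (simp add: M_def convergent_def)
  have all: "y \<in> M" for y
  proof -
    obtain m where m: "m \<in> M" "\<And>z. z \<in> M \<Longrightarrow> (y - m) \<bullet> z = 0"
      using nearest_point_subspace_orthogonal[OF clo sub] by blast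
    have "x n \<bullet> y = x n \<bullet> m" for n
      using m(2)[OF xM, of n] by (simp add: inner_diff_left inner_commute[of "x n"])
    then show ?thesis using m(1) by (simp add: M_def)
  qed
  define \<phi> where "\<phi> y = lim (\<lambda>n. x (r n) \<bullet> y)" for y
  have \<phi>: "(\<lambda>n. x (r n) \<bullet> y) \<longlonglongrightarrow> \<phi> y" for y
    using all[of y] by (simp add: M_def \<phi>_def convergent_LIMSEQ_iff)
  have "bounded_linear \<phi>"
  proof (rule bounded_linear_intro)
    fix y z c
    show "\<phi> (y + z) = \<phi> y + \<phi> z"
      using tendsto_add[OF \<phi> \<phi>, of y z] \<phi>[of "y + z"]
      by (auto simp: inner_add_right dest: LIMSEQ_unique)
    show "\<phi> (c *\<^sub>R y) = c *\<^sub>R \<phi> y"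
      using tendsto_mult_left[OF \<phi>, of c y] \<phi>[of "c *\<^sub>R y"]
      by (auto dest: LIMSEQ_unique)
    have "(\<lambda>n. \<bar>x (r n) \<bullet> y\<bar>) \<longlonglongrightarrow> \<bar>\<phi> y\<bar>" using \<phi> by (rule tendsto_rabs)
    moreover have "\<bar>x (r n) \<bullet> y\<bar> \<le> norm y * B" for n
      using Cauchy_Schwarz_ineq2[of "x (r n)" y] mult_right_mono[OF B(2)[of "r n"], of "norm y"]
      by (simp add: mult.commute)
    ultimately show "norm (\<phi> y) \<le> norm y * B"
      by (auto intro: LIMSEQ_le_const2)
  qed
  then obtain l where "\<And>y. \<phi> y = l \<bullet> y" using Riesz_representation by blast
  then have "weak_lim (\<lambda>n. x (r n)) l" using \<phi> by (simp add: weak_lim_def)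
  with r that show ?thesis by blast
qed

text \<open>
  For weak cluster points \<open>l\<close> and \<open>l'\<close>, which belong to \<open>S\<close>, the quantity \<open>|x n - l'|\<^sup>2 - |x n - l|\<^sup>2\<close>
  converges, and up to constants this is \<open>2 x n \<bullet> (l - l')\<close>. Its limit can be computed along both subsequences, giving
  \<open>l \<bullet> (l - l') = l' \<bullet> (l - l')\<close>. So the cluster point is unique, and weak compactness does the rest.
\<close>
lemma Opial_weak_lim:
  fixes x :: "nat \<Rightarrow> 'a::{real_inner, complete_space}"
  assumes "S \<noteq> {}"
    and conv: "\<And>z. z \<in> S \<Longrightarrow> convergent (\<lambda>n. norm (x n - z))"
    and clus: "\<And>r l. strict_mono r \<Longrightarrow> weak_lim (\<lambda>n. x (r n)) l \<Longrightarrow> l \<in> S"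
  obtains l where "l \<in> S" "weak_lim x l"
proof -
  obtain z where z: "z \<in> S" using assms(1) by blast
  obtain B where B: "\<And>n. norm (x n - z) \<le> B"
    using convergent_imp_Bseq[OF conv[OF z]] by (auto simp: Bseq_def)
  have "norm (x n) \<le> B + norm z" for n
    using norm_triangle_sub[of "x n" z] B[of n] by linarith
  then have bdd: "bounded (range (\<lambda>n. x (s n)))" for s :: "nat \<Rightarrow> nat"
    by (auto simp: bounded_iff)
  obtain r l where r: "strict_mono r" and l: "weak_lim (\<lambda>n. x (r n)) l"
    using bounded_imp_weak_lim_subseq[of x] bdd[of "\<lambda>n. n"] by auto
  have lS: "l \<in> S" using clus[OF r l] .
  have uniq: "l' = l" if r': "strict_mono r'" and l': "weak_lim (\<lambda>n. x (r' n)) l'" for r' l'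
  proof -
    obtain a c where a: "(\<lambda>n. norm (x n - l)) \<longlonglongrightarrow> a" and c: "(\<lambda>n. norm (x n - l')) \<longlonglongrightarrow> c"
      using conv[OF lS] conv[OF clus[OF r' l']] by (auto simp: convergent_def)
    have "(\<lambda>n. ((norm (x n - l'))\<^sup>2 - (norm (x n - l))\<^sup>2 - l' \<bullet> l' + l \<bullet> l) / 2)
        \<longlonglongrightarrow> (c\<^sup>2 - a\<^sup>2 - l' \<bullet> l' + l \<bullet> l) / 2" (is "_ \<longlonglongrightarrow> ?K")
      using a c by (intro tendsto_intros) auto
    moreover have "((norm (x n - l'))\<^sup>2 - (norm (x n - l))\<^sup>2 - l' \<bullet> l' + l \<bullet> l) / 2
        = x n \<bullet> (l - l')" for n
      unfolding power2_norm_eq_inner inner_diff_left inner_diff_right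
      by (simp add: inner_commute field_simps)
    ultimately have K: "(\<lambda>n. x n \<bullet> (l - l')) \<longlonglongrightarrow> ?K" by simp
    have "l \<bullet> (l - l') = ?K"
      using LIMSEQ_subseq_LIMSEQ[OF K r] weak_limD[OF l, of "l - l'"]
      by (auto simp: o_def dest: LIMSEQ_unique)
    moreover have "l' \<bullet> (l - l') = ?K"
      using LIMSEQ_subseq_LIMSEQ[OF K r'] weak_limD[OF l', of "l - l'"]
      by (auto simp: o_def dest: LIMSEQ_unique)
    ultimately have "(l - l') \<bullet> (l - l') = 0" by (simp add: inner_diff_left)
    then show ?thesis by simp
  qed
  have "weak_lim x l"
    unfolding weak_lim_def
  proof (rule allI, rule ccontr)
    fix y assume "\<not> (\<lambda>n. x n \<bullet> y) \<longlonglongrightarrow> l \<bullet> y"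
    then obtain e where e: "e > 0" "\<exists>\<^sub>F n in sequentially. dist (x n \<bullet> y) (l \<bullet> y) \<ge> e"
      by (auto simp: tendsto_iff frequently_def not_le)
    then have "infinite {n. dist (x n \<bullet> y) (l \<bullet> y) \<ge> e}"
      by (simp add: frequently_cofinite cofinite_eq_sequentially[symmetric])
    from infinite_enumerate[OF this] obtain s :: "nat \<Rightarrow> nat" where s: "strict_mono s"
      and se: "\<And>n. dist (x (s n) \<bullet> y) (l \<bullet> y) \<ge> e"
      by auto
    obtain r' l' where r': "strict_mono r'" and l': "weak_lim (\<lambda>n. x (s (r' n))) l'"
      using bounded_imp_weak_lim_subseq[OF bdd[of s]] by auto
    have "l' = l"
      using uniq[of "s \<circ> r'" l'] l' strict_mono_o[OF s r'] by (simp add: o_def)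
    then have "(\<lambda>n. x (s (r' n)) \<bullet> y) \<longlonglongrightarrow> l \<bullet> y"
      using weak_limD[OF l'] by simp
    then obtain n where "dist (x (s (r' n)) \<bullet> y) (l \<bullet> y) < e"
      using metric_LIMSEQ_D[OF _ e(1)] by blast
    with se[of "r' n"] show False by simp
  qed
  with lS that show ?thesis by blast
qed

lemma limitin_weak_topology:
  fixes x :: "nat \<Rightarrow> 'a::{real_inner, complete_space}"
  assumes "weak_lim x l"
  shows "limitin weak_topology x l sequentially"
proof -
  let ?B = "{\<phi> -` V |(\<phi> :: 'a \<Rightarrow> real) V. bounded_linear \<phi> \<and> open V}"
  have "generate_topology_on ?B U \<Longrightarrow> l \<in> U \<longrightarrow> (\<forall>\<^sub>F n in sequentially. x n \<in> U)" for U
  proof (induction rule: generate_topology_on.induct)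
    case (Int a b)
    then show ?case by (auto intro: eventually_conj)
  next
    case (UN K)
    show ?case
    proof
      assume "l \<in> \<Union>K"
      then obtain k where "k \<in> K" "l \<in> k" by blast
      with UN.IH[of k] have "\<forall>\<^sub>F n in sequentially. x n \<in> k" by blast
      with \<open>k \<in> K\<close> show "\<forall>\<^sub>F n in sequentially. x n \<in> \<Union>K"
        by (auto elim: eventually_mono)
    qed
  next
    case (Basis s)
    then obtain \<phi> :: "'a \<Rightarrow> real" and V where s: "s = \<phi> -` V" "bounded_linear \<phi>" "open V" by blast
    obtain y where y: "\<And>x. \<phi> x = y \<bullet> x" using Riesz_representation[OF s(2)] by blast
    have "(\<lambda>n. \<phi> (x n)) \<longlonglongrightarrow> \<phi> l" using weak_limD'[OF assms] by (simp add: y)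
    then show ?case using s by (auto dest: topological_tendstoD)
  qed simp
  moreover have "UNIV \<in> ?B"
    by (rule CollectI, rule exI[of _ "\<lambda>_. 0"], rule exI[of _ UNIV]) auto
  then have "l \<in> topspace (weak_topology :: 'a topology)"
    by (auto simp: weak_topology_def)
  ultimately show ?thesis
    by (simp add: limitin_def weak_topology_def openin_topology_generated_by_iff)
qed

lemma weak_cluster_point_tendsto:
  assumes "weak_cluster_point x l" "bounded_linear \<phi>" "(\<lambda>n. \<phi> (x n)) \<longlonglongrightarrow> c"
  shows "\<phi> l = (c :: real)"
proof (rule ccontr)
  assume "\<phi> l \<noteq> c"
  then obtain U V where UV: "open U" "open V" "\<phi> l \<in> U" "c \<in> V" "U \<inter> V = {}"
    by (meson hausdorff)
  have "openin weak_topology (\<phi> -` U)"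
    unfolding weak_topology_def openin_topology_generated_by_iff
    using assms(2) UV(1) by (intro generate_topology_on.Basis) blast
  then have "\<exists>\<^sub>F n in sequentially. \<phi> (x n) \<in> U"
    using assms(1) UV(3) by (auto simp: weak_cluster_point_def)
  moreover have "\<forall>\<^sub>F n in sequentially. \<phi> (x n) \<in> V"
    using assms(3) UV by (auto dest: topological_tendstoD)
  ultimately have "\<exists>\<^sub>F n in sequentially. \<phi> (x n) \<in> U \<and> \<phi> (x n) \<in> V"
    by (rule frequently_eventually_frequently)
  then show False using UV(5) by (auto dest: frequently_ex)
qed

section \<open>Convex conjugates and subdifferentials\<close>

lemma lower_semicontinuous_limit_le:
  fixes F :: "'a::topological_space \<Rightarrow> ereal"
  assumes "lower_semicontinuous F" "x \<longlonglongrightarrow> l" "\<And>n. F (x n) \<le> ereal (t n)" "t \<longlonglongrightarrow> r"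
  shows "F l \<le> ereal r"
proof (rule ccontr)
  assume "\<not> F l \<le> ereal r"
  then obtain s where s: "r < s" "ereal s < F l"
    using ereal_dense2[of "ereal r" "F l"] by (metis less_ereal.simps(1) not_le)
  have "eventually (\<lambda>y. ereal s < F y) (at l)"
    using assms(1) s(2) by (auto simp: lower_semicontinuous_def le_Liminf_iff)
  then have "eventually (\<lambda>y. ereal s < F y) (nhds l)"
    unfolding eventually_at_filter by (rule eventually_mono) (use s(2) in auto)
  then have "eventually (\<lambda>n. ereal s < F (x n)) sequentially"
    using assms(2) by (rule eventually_compose_filterlim)
  moreover have "eventually (\<lambda>n. t n < s) sequentially"
    using assms(4) s(1) by (rule order_tendstoD)
  ultimately have "eventually (\<lambda>n. False) sequentially"
  proof eventually_elim
    case (elim n)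
    then show False using assms(3)[of n] by (meson ereal_less_ereal_Ex leD less_ereal.simps(1) order_less_le_trans order_less_trans)
  qed
  then show False by simp
qed

lemma convex_fun_le:
  assumes "convex_fun F" "F x \<le> ereal s" "F y \<le> ereal t" "0 \<le> v" "v \<le> 1"
  shows "F ((1 - v) *\<^sub>R x + v *\<^sub>R y) \<le> ereal ((1 - v) * s + v * t)"
proof (cases "0 < v \<and> v < 1")
  case True
  then have "F ((1 - v) *\<^sub>R x + v *\<^sub>R y) \<le> ereal (1 - v) * F x + ereal v * F y"
    using assms(1) by (auto simp: convex_fun_def)
  also have "\<dots> \<le> ereal (1 - v) * ereal s + ereal v * ereal t"
    using assms True by (intro add_mono ereal_mult_left_mono) auto
  finally show ?thesis by simp
next
  case False
  then have "v = 0 \<or> v = 1" using assms by auto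
  then show ?thesis using assms by auto
qed

lemma closed_epigraph:
  fixes F :: "'a::real_normed_vector \<Rightarrow> ereal"
  assumes "lower_semicontinuous F"
  shows "closed {(x, t). F x \<le> ereal t}"
  unfolding closed_sequential_limits
proof (intro allI impI, elim conjE)
  fix z :: "nat \<Rightarrow> 'a \<times> real" and l
  assume z: "\<forall>n. z n \<in> {(x, t). F x \<le> ereal t}" "z \<longlonglongrightarrow> l"
  have "F (fst l) \<le> ereal (snd l)"
    using tendsto_fst[OF z(2)] _ tendsto_snd[OF z(2)]
    by (rule lower_semicontinuous_limit_le[OF assms]) (use z(1) in \<open>auto simp: case_prod_beta\<close>)
  then show "l \<in> {(x, t). F x \<le> ereal t}" by (simp add: case_prod_beta)
qed

lemma convex_epigraph:
  assumes "convex_fun F"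
  shows "convex {(x, t). F x \<le> ereal t}"
proof (rule convexI)
  fix p q and u v :: real
  assume *: "p \<in> {(x, t). F x \<le> ereal t}" "q \<in> {(x, t). F x \<le> ereal t}" "0 \<le> u" "0 \<le> v" "u + v = 1"
  then have u: "u = 1 - v" by simp
  show "u *\<^sub>R p + v *\<^sub>R q \<in> {(x, t). F x \<le> ereal t}"
    using convex_fun_le[OF assms, of "fst p" "snd p" "fst q" "snd q" v] *
    unfolding u by (auto simp: case_prod_beta)
qed

text \<open>
  Upper bounds on the conjugate are affine minorants of the function. Arguments below phrase
  statements on conjugates through such real bounds, which avoids arithmetic with infinite values.
\<close>
lemma conjugate_le_iff:
  "conjugate F p \<le> ereal s \<longleftrightarrow> (\<forall>x. ereal (p \<bullet> x - s) \<le> F x)"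
proof -
  have "ereal (p \<bullet> x) - F x \<le> ereal s \<longleftrightarrow> ereal (p \<bullet> x - s) \<le> F x" for x
    by (cases "F x") auto
  then show ?thesis by (auto simp: conjugate_def SUP_le_iff)
qed

lemma conjugate_leI:
  assumes "proper F" "\<And>x t. F x \<le> ereal t \<Longrightarrow> p \<bullet> x - s \<le> t"
  shows "conjugate F p \<le> ereal s"
  unfolding conjugate_le_iff
proof
  fix x show "ereal (p \<bullet> x - s) \<le> F x"
    using assms(1) assms(2)[of x] by (cases "F x") (auto simp: proper_def)
qed

lemma conjugate_leD: "conjugate F p \<le> ereal s \<Longrightarrow> F x \<le> ereal t \<Longrightarrow> p \<bullet> x - s \<le> t"
  unfolding conjugate_le_iff by (metis ereal_less_eq(3) order_trans)

lemma proper_obtain: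
  assumes "proper F" obtains x t where "F x = ereal t"
proof -
  obtain x where "F x < \<infinity>" using assms by (auto simp: proper_def effective_domain_def)
  then show ?thesis using that[of x] assms by (cases "F x") (auto simp: proper_def)
qed

lemma conjugate_not_MInf:
  assumes "proper F" shows "conjugate F p \<noteq> - \<infinity>"
proof
  obtain x t where "F x = ereal t" using proper_obtain[OF assms] .
  moreover assume "conjugate F p = - \<infinity>"
  ultimately show False using conjugate_leD[of F p "p \<bullet> x - t - 1" x t] by simp
qed

text \<open>
  Project \<open>(u, r)\<close> on the epigraph. The vector from the nearest point to \<open>(u, r)\<close> is a normal of a
  separating hyperplane; if the hyperplane is not vertical it is the graph of an affine minorant
  exceeding \<open>r\<close> at \<open>u\<close>, otherwise it separates \<open>u\<close> from the effective domain.
\<close>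
lemma epigraph_separation:
  fixes F :: "'a::{real_inner, complete_space} \<Rightarrow> ereal"
  assumes F: "proper F" "convex_fun F" "lower_semicontinuous F" and u: "\<not> F u \<le> ereal r"
  shows "(\<exists>p s. conjugate F p \<le> ereal s \<and> r < p \<bullet> u - s) \<or>
         (\<exists>w c. c < w \<bullet> u \<and> (\<forall>x t. F x \<le> ereal t \<longrightarrow> w \<bullet> x \<le> c))"
proof -
  let ?E = "{(x, t). F x \<le> ereal t}"
  obtain x1 t1 where "F x1 = ereal t1" using proper_obtain[OF F(1)] .
  then have "(x1, t1) \<in> ?E" by simp
  then have "?E \<noteq> {}" by blast
  then obtain z where zE: "z \<in> ?E" and z: "\<And>y. y \<in> ?E \<Longrightarrow> ((u, r) - z) \<bullet> (y - z) \<le> 0"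
    using ex_nearest_point_variational[OF closed_epigraph convex_epigraph] F by metis
  obtain x0 t0 where z0: "z = (x0, t0)" by fastforce
  have F0: "F x0 \<le> ereal t0" using zE z0 by simp
  have sep: "(u - x0) \<bullet> (x - x0) + (r - t0) * (t - t0) \<le> 0" if "F x \<le> ereal t" for x t
    using z[of "(x, t)"] that by (simp add: z0 inner_prod_def)
  have "F x0 \<le> ereal (t0 + 1)" using F0 by (rule order_trans) simp
  then have "r \<le> t0" using sep[of x0 "t0 + 1"] by simp
  then consider "r < t0" | "r = t0" by linarith
  then show ?thesis
  proof cases
    case 1
    define p where "p = (1 / (t0 - r)) *\<^sub>R (u - x0)"
    have "conjugate F p \<le> ereal (p \<bullet> x0 - t0)"
    proof (rule conjugate_leI[OF F(1)])
      fix x t assume "F x \<le> ereal t"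
      from sep[OF this] have "(u - x0) \<bullet> (x - x0) \<le> (t0 - r) * (t - t0)"
        by (simp add: algebra_simps)
      moreover have "p \<bullet> (x - x0) = (u - x0) \<bullet> (x - x0) / (t0 - r)"
        by (simp add: p_def)
      ultimately have "p \<bullet> (x - x0) \<le> t - t0"
        using 1 by (simp add: pos_divide_le_eq mult.commute)
      then show "p \<bullet> x - (p \<bullet> x0 - t0) \<le> t" by (simp add: inner_diff_right)
    qed
    moreover have "0 \<le> p \<bullet> (u - x0)"
      using 1 by (simp add: p_def)
    then have "r < p \<bullet> u - (p \<bullet> x0 - t0)" using 1 by (simp add: inner_diff_right)
    ultimately show ?thesis by blast
  next
    case 2
    have "u \<noteq> x0" using u F0 2 by auto
    then have "0 < (u - x0) \<bullet> (u - x0)" by simp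
    then have "(u - x0) \<bullet> x0 < (u - x0) \<bullet> u" by (simp add: inner_diff_right)
    moreover have "(u - x0) \<bullet> x \<le> (u - x0) \<bullet> x0" if "F x \<le> ereal t" for x t
      using sep[OF that] 2 by (simp add: inner_diff_right)
    ultimately show ?thesis by blast
  qed
qed

text \<open>
  The assumption says that the biconjugate at \<open>u\<close> is at most \<open>r\<close>. A vertical separating hyperplane
  cannot occur over a point of the domain, so there is some affine minorant; where the hyperplane at
  \<open>u\<close> is vertical, adding a large multiple of its normal to that minorant lifts it above \<open>r\<close>.
\<close>
theorem Fenchel_Moreau:
  fixes F :: "'a::{real_inner, complete_space} \<Rightarrow> ereal"
  assumes F: "proper F" "convex_fun F" "lower_semicontinuous F"
    and r: "\<And>p s. conjugate F p \<le> ereal s \<Longrightarrow> p \<bullet> u - s \<le> r"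
  shows "F u \<le> ereal r"
proof (rule ccontr)
  assume "\<not> F u \<le> ereal r"
  from epigraph_separation[OF F this] r
  obtain w c where w: "c < w \<bullet> u" "\<And>x t. F x \<le> ereal t \<Longrightarrow> w \<bullet> x \<le> c"
    by force
  obtain x1 t1 where x1: "F x1 = ereal t1" using proper_obtain[OF F(1)] .
  then have "\<not> F x1 \<le> ereal (t1 - 1)" by simp
  from epigraph_separation[OF F this]
  obtain p s where ps: "conjugate F p \<le> ereal s"
    using x1 by (metis dual_order.refl leD)
  define k where "k = max 0 ((r + s + 1 - p \<bullet> u) / (w \<bullet> u - c))"
  have k: "0 \<le> k" "r + s + 1 - p \<bullet> u \<le> k * (w \<bullet> u - c)"
  proof -
    have "(r + s + 1 - p \<bullet> u) / (w \<bullet> u - c) \<le> k" by (simp add: k_def)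
    then show "r + s + 1 - p \<bullet> u \<le> k * (w \<bullet> u - c)" using w(1) by (simp add: divide_le_eq)
  qed (simp add: k_def)
  have "conjugate F (p + k *\<^sub>R w) \<le> ereal (s + k * c)"
  proof (rule conjugate_leI[OF F(1)])
    fix x t assume *: "F x \<le> ereal t"
    show "(p + k *\<^sub>R w) \<bullet> x - (s + k * c) \<le> t"
      using conjugate_leD[OF ps *] mult_left_mono[OF w(2)[OF *] k(1)]
      by (simp add: inner_add_left)
  qed
  from r[OF this] k(2) show False by (simp add: inner_add_left algebra_simps)
qed

text \<open>
  By the Fenchel-Moreau theorem \<open>F\<close> is a supremum of affine functions, and these are weakly continuous.
\<close>
lemma weak_lim_le:
  fixes F :: "'a::{real_inner, complete_space} \<Rightarrow> ereal"
  assumes F: "proper F" "convex_fun F" "lower_semicontinuous F"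
    and "weak_lim x l" "\<And>n. F (x n) \<le> ereal r"
  shows "F l \<le> ereal r"
proof (rule Fenchel_Moreau[OF F])
  fix p s assume ps: "conjugate F p \<le> ereal s"
  have "(\<lambda>n. p \<bullet> x n - s) \<longlonglongrightarrow> p \<bullet> l - s"
    by (intro tendsto_diff tendsto_const weak_limD' assms)
  then show "p \<bullet> l - s \<le> r"
    by (rule LIMSEQ_le_const2) (use conjugate_leD[OF ps assms(5)] in auto)
qed

lemma subdifferentialE:
  assumes "p \<in> subdifferential F x"
  obtains r where "F x = ereal r" "\<And>y t. F y \<le> ereal t \<Longrightarrow> r + p \<bullet> (y - x) \<le> t"
proof -
  obtain r where r: "F x = ereal r" using assms by (cases "F x") (auto simp: subdifferential_def)
  have "r + p \<bullet> (y - x) \<le> t" if "F y \<le> ereal t" for y t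
  proof -
    have "ereal (r + p \<bullet> (y - x)) \<le> F y" using assms r by (auto simp: subdifferential_def)
    also note that
    finally show ?thesis by simp
  qed
  with r that show ?thesis by blast
qed

lemma subdifferentialI:
  assumes "\<And>y. F y \<noteq> - \<infinity>" "F x = ereal r" "\<And>y t. F y \<le> ereal t \<Longrightarrow> r + p \<bullet> (y - x) \<le> t"
  shows "p \<in> subdifferential F x"
  unfolding subdifferential_def
proof (intro CollectI conjI allI)
  fix y show "F x + ereal (p \<bullet> (y - x)) \<le> F y"
    using assms(1)[of y] assms(2) assms(3)[of y] by (cases "F y") auto
qed (simp add: assms(2))

lemma subdifferential_monotone:
  assumes "p \<in> subdifferential F x" "q \<in> subdifferential F y"
  shows "0 \<le> (p - q) \<bullet> (x - y)"
proof -
  obtain r where r: "F x = ereal r" "\<And>z t. F z \<le> ereal t \<Longrightarrow> r + p \<bullet> (z - x) \<le> t"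
    using assms(1) by (rule subdifferentialE) blast
  obtain s where s: "F y = ereal s" "\<And>z t. F z \<le> ereal t \<Longrightarrow> s + q \<bullet> (z - y) \<le> t"
    using assms(2) by (rule subdifferentialE) blast
  show ?thesis using r(2)[of y s] s(2)[of x r] r(1) s(1)
    by (simp add: inner_diff_right inner_diff_left)
qed

lemma conjugate_le_of_subdifferential:
  assumes "proper F" "p \<in> subdifferential F x" "F x = ereal r"
  shows "conjugate F p \<le> ereal (p \<bullet> x - r)"
proof (rule conjugate_leI[OF assms(1)])
  fix y t assume *: "F y \<le> ereal t"
  have "r + p \<bullet> (y - x) \<le> t"
    using assms(2) by (rule subdifferentialE) (use assms(3) * in auto)
  then show "p \<bullet> y - (p \<bullet> x - r) \<le> t" by (simp add: inner_diff_right)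
qed

text \<open>
  The subgradient inequality for the conjugate at \<open>p\<close> bounds the biconjugate at \<open>x\<close> by
  \<open>p \<bullet> x - conjugate F p\<close>, so Fenchel-Young is an equality at \<open>(x, p)\<close>.
\<close>
lemma subdifferential_of_conjugate:
  fixes F :: "'a::{real_inner, complete_space} \<Rightarrow> ereal"
  assumes F: "proper F" "convex_fun F" "lower_semicontinuous F"
    and x: "x \<in> subdifferential (conjugate F) p"
  shows "p \<in> subdifferential F x"
proof -
  obtain c where c: "conjugate F p = ereal c"
    and le: "\<And>q s. conjugate F q \<le> ereal s \<Longrightarrow> c + x \<bullet> (q - p) \<le> s"
    using x by (rule subdifferentialE) blast
  have "F x \<le> ereal (p \<bullet> x - c)"
    by (rule Fenchel_Moreau[OF F])
       (use le in \<open>force simp: inner_diff_right inner_commute\<close>)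
  then obtain r where r: "F x = ereal r" "r \<le> p \<bullet> x - c"
    using F(1) by (cases "F x") (auto simp: proper_def)
  show ?thesis
  proof (rule subdifferentialI[where F = F and x = x and r = r])
    fix y t assume "F y \<le> ereal t"
    from conjugate_leD[of F p c, OF _ this] c r(2)
    show "r + p \<bullet> (y - x) \<le> t" by (simp add: inner_diff_right)
  qed (use F(1) r in \<open>auto simp: proper_def\<close>)
qed

lemma minimizer_le: "minimizer F x \<Longrightarrow> F x \<le> F y" for F :: "'a \<Rightarrow> ereal"
  by (simp add: is_arg_min_linorder)

text \<open>
  The first-order condition: compare the minimizer \<open>x\<close> with \<open>(1 - v) x + v y\<close> and let \<open>v\<close> tend
  to \<open>0\<close>; the quadratic remainder is of order \<open>v\<^sup>2\<close>.
\<close>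
lemma minimizer_plus_quadratic:
  fixes F :: "'a::real_vector \<Rightarrow> ereal" and L :: "'a \<Rightarrow> 'b::real_inner"
  assumes F: "proper F" "convex_fun F" and L: "linear L"
    and min: "minimizer (\<lambda>x. F x + ereal (lam / 2 * (norm (c + L x))\<^sup>2)) x"
  obtains r where "F x = ereal r"
    and "\<And>y t. F y \<le> ereal t \<Longrightarrow> r - lam * ((c + L x) \<bullet> L (y - x)) \<le> t"
proof -
  obtain x1 t1 where x1: "F x1 = ereal t1" using proper_obtain[OF F(1)] .
  obtain r where r: "F x = ereal r"
    using minimizer_le[OF min, of x1] F(1) x1 by (cases "F x") (auto simp: proper_def)
  have "r - lam * ((c + L x) \<bullet> L (y - x)) \<le> t" if t: "F y \<le> ereal t" for y t
  proof (rule ccontr)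
    assume neg: "\<not> ?thesis"
    define K where "K = \<bar>lam / 2 * (norm (L (y - x)))\<^sup>2\<bar>"
    define a where "a = r - lam * ((c + L x) \<bullet> L (y - x)) - t"
    have a: "a > 0" using neg by (simp add: a_def)
    \<comment> \<open>The violation \<open>a\<close> enters with factor \<open>v\<close>, the remainder with \<open>v\<^sup>2 K\<close>; this \<open>v\<close> makes the
      remainder lose.\<close>
    define v where "v = min 1 (a / (2 * (K + 1)))"
    have K: "K \<ge> 0" by (simp add: K_def)
    have v: "0 < v" "v \<le> 1" "v * K < a"
    proof -
      have "v * (K + 1) \<le> a / (2 * (K + 1)) * (K + 1)"
        using K by (intro mult_right_mono) (auto simp: v_def)
      also have "\<dots> = a / 2" using K by (simp add: field_simps)
      finally have "v * (K + 1) < a" using a by simp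
      moreover show "0 < v" "v \<le> 1" using a K by (auto simp: v_def)
      ultimately show "v * K < a" by (simp add: algebra_simps)
    qed
    let ?z = "(1 - v) *\<^sub>R x + v *\<^sub>R y"
    have z: "F ?z \<le> ereal ((1 - v) * r + v * t)"
      using convex_fun_le[OF F(2), of x r y t v] r t v by simp
    have "ereal (r + lam / 2 * (norm (c + L x))\<^sup>2) \<le> F ?z + ereal (lam / 2 * (norm (c + L ?z))\<^sup>2)"
      using minimizer_le[OF min, of ?z] r by simp
    also have "\<dots> \<le> ereal ((1 - v) * r + v * t) + ereal (lam / 2 * (norm (c + L ?z))\<^sup>2)"
      using z by (intro add_mono) auto
    finally have 1: "r + lam / 2 * (norm (c + L x))\<^sup>2
        \<le> (1 - v) * r + v * t + lam / 2 * (norm (c + L ?z))\<^sup>2" by simp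
    have Lz: "c + L ?z = (c + L x) + v *\<^sub>R L (y - x)"
      using L by (simp add: linear_add linear_scale linear_diff algebra_simps)
    have "(norm (c + L ?z))\<^sup>2 = (norm (c + L x))\<^sup>2 + 2 * v * ((c + L x) \<bullet> L (y - x))
        + v * (v * (norm (L (y - x)))\<^sup>2)"
      unfolding Lz power2_norm_eq_inner by (simp add: inner_commute algebra_simps)
    then have "lam / 2 * (norm (c + L ?z))\<^sup>2 = lam / 2 * (norm (c + L x))\<^sup>2
        + lam / 2 * (2 * v * ((c + L x) \<bullet> L (y - x)) + v * (v * (norm (L (y - x)))\<^sup>2))"
      by (simp only: distrib_left add.assoc)
    with 1 have "r \<le> (1 - v) * r + v * t + lam / 2 * (2 * v * ((c + L x) \<bullet> L (y - x))
        + v * (v * (norm (L (y - x)))\<^sup>2))"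
      by linarith
    then have "v * r \<le> v * t + lam / 2 * (2 * v * ((c + L x) \<bullet> L (y - x))
        + v * (v * (norm (L (y - x)))\<^sup>2))"
      by (simp add: left_diff_distrib)
    also have "\<dots> = v * (t + lam * ((c + L x) \<bullet> L (y - x)) + v * (lam / 2 * (norm (L (y - x)))\<^sup>2))"
      by (simp add: algebra_simps)
    finally have "r \<le> t + lam * ((c + L x) \<bullet> L (y - x)) + v * (lam / 2 * (norm (L (y - x)))\<^sup>2)"
      using v(1) by simp
    then have "a \<le> v * (lam / 2 * (norm (L (y - x)))\<^sup>2)" by (simp add: a_def)
    also have "\<dots> \<le> v * K" using v(1) by (intro mult_left_mono) (auto simp: K_def)
    finally show False using v(3) by simp
  qed
  with r that show ?thesis by blast
qed

section \<open>Optimality pairs and Fenchel-Rockafellar duality\<close>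

definition KKT_pair where
  "KKT_pair f g L u p \<longleftrightarrow> - adjoint L p \<in> subdifferential g u \<and> p \<in> subdifferential f (L u)"

text \<open>
  The subgradients \<open>-L\<^sup>* p\<close> and \<open>p\<close> cancel when the two subgradient inequalities are added.
\<close>
lemma KKT_imp_primal_minimizer:
  fixes L :: "'a::{real_inner, complete_space} \<Rightarrow> 'b::real_inner"
  assumes "bounded_linear L" "proper g" "proper f" "KKT_pair f g L u p"
  shows "minimizer (primal_objective f g L) u"
proof -
  note adj = inner_adjoint_Hilbert[OF assms(1)]
  have g0: "- adjoint L p \<in> subdifferential g u" and f0: "p \<in> subdifferential f (L u)"
    using assms(4) by (auto simp: KKT_pair_def)
  obtain a where a: "g u = ereal a"
    and ga: "\<And>x t. g x \<le> ereal t \<Longrightarrow> a + (- adjoint L p) \<bullet> (x - u) \<le> t"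
    using g0 by (rule subdifferentialE) blast
  obtain b where b: "f (L u) = ereal b" and fb: "\<And>y t. f y \<le> ereal t \<Longrightarrow> b + p \<bullet> (y - L u) \<le> t"
    using f0 by (rule subdifferentialE) blast
  have "primal_objective f g L u \<le> primal_objective f g L x" for x
  proof (cases "\<exists>s t. g x = ereal s \<and> f (L x) = ereal t")
    case True
    then obtain s t where st: "g x = ereal s" "f (L x) = ereal t" by blast
    have "(- adjoint L p) \<bullet> (x - u) = - (p \<bullet> (L x - L u))"
      by (simp add: inner_diff_right adj)
    then show ?thesis
      using ga[of x s] fb[of "L x" t] st a b by (simp add: primal_objective_def)
  next
    case False
    then have "primal_objective f g L x = \<infinity>"
      using assms(2,3) by (cases "g x"; cases "f (L x)") (auto simp: primal_objective_def proper_def)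
    then show ?thesis by simp
  qed
  then show ?thesis by (simp add: is_arg_min_linorder)
qed

text \<open>
  Fenchel-Young is an equality at a KKT pair and an inequality for every other dual point; the terms
  containing \<open>L u\<close> cancel.
\<close>
lemma KKT_imp_dual_minimizer:
  fixes L :: "'a::{real_inner, complete_space} \<Rightarrow> 'b::real_inner"
  assumes "bounded_linear L" "proper g" "proper f" "KKT_pair f g L u p"
  shows "minimizer (dual_objective f g L) p"
proof -
  note adj = inner_adjoint_Hilbert[OF assms(1)]
  have g0: "- adjoint L p \<in> subdifferential g u" and f0: "p \<in> subdifferential f (L u)"
    using assms(4) by (auto simp: KKT_pair_def)
  obtain a where a: "g u = ereal a" using g0 by (rule subdifferentialE)
  obtain b where b: "f (L u) = ereal b" using f0 by (rule subdifferentialE)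
  have ip: "(- adjoint L c) \<bullet> u = - (c \<bullet> L u)" for c
    by (simp add: adj)
  have "dual_objective f g L p \<le> ereal (- (p \<bullet> L u) - a) + ereal (p \<bullet> L u - b)"
    unfolding dual_objective_def
    using conjugate_le_of_subdifferential[OF assms(2) g0 a]
      conjugate_le_of_subdifferential[OF assms(3) f0 b] ip
    by (intro add_mono) auto
  also have "\<dots> = ereal (- a - b)" by simp
  finally have "dual_objective f g L p \<le> ereal (- a - b)" .
  moreover have "ereal (- a - b) \<le> dual_objective f g L c" for c
  proof -
    have "ereal (- (c \<bullet> L u) - a) \<le> conjugate g (- adjoint L c)"
      unfolding conjugate_def using a ip by (intro SUP_upper2[of u]) auto
    moreover have "ereal (c \<bullet> L u - b) \<le> conjugate f c"
      unfolding conjugate_def using b by (intro SUP_upper2[of "L u"]) auto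
    ultimately have "ereal (- (c \<bullet> L u) - a) + ereal (c \<bullet> L u - b) \<le> dual_objective f g L c"
      unfolding dual_objective_def by (rule add_mono)
    then show ?thesis by simp
  qed
  ultimately have "dual_objective f g L p \<le> dual_objective f g L c" for c
    by (rule order_trans)
  then show ?thesis by (simp add: is_arg_min_linorder)
qed

text \<open>
  Continuity makes \<open>f\<close> finite on a ball around \<open>L x\<close>, and \<open>0\<close> is an interior point of \<open>L x\<close> minus that
  ball.
\<close>
lemma regularity1_imp_regularity2:
  fixes f :: "'b::real_normed_vector \<Rightarrow> ereal" and L :: "'a \<Rightarrow> 'b"
  assumes "regularity1 f g L"
  shows "regularity2 f g L"
proof -
  obtain x where x: "x \<in> effective_domain g" "f (L x) < \<infinity>" "isCont f (L x)"
    using assms by (auto simp: regularity1_def effective_domain_def)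
  have "eventually (\<lambda>y. f y < \<infinity>) (at (L x))"
    using x(3) x(2) unfolding isCont_def by (rule order_tendstoD)
  then have "eventually (\<lambda>y. f y < \<infinity>) (nhds (L x))"
    unfolding eventually_at_filter by (rule eventually_mono) (use x(2) in auto)
  then obtain e where e: "e > 0" "\<And>y. dist y (L x) < e \<Longrightarrow> f y < \<infinity>"
    by (auto simp: eventually_nhds_metric)
  have "ball 0 e \<subseteq> {L x - y | x y. x \<in> effective_domain g \<and> y \<in> effective_domain f}"
  proof
    fix z :: 'b assume "z \<in> ball 0 e"
    then have "L x - z \<in> effective_domain f"
      using e(2)[of "L x - z"] by (simp add: dist_norm effective_domain_def)
    then show "z \<in> {L x - y | x y. x \<in> effective_domain g \<and> y \<in> effective_domain f}"
      using x(1) by (intro CollectI exI[of _ x] exI[of _ "L x - z"]) auto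
  qed
  then show ?thesis
    unfolding regularity2_def using e(1) by (meson centre_in_ball interiorI open_ball)
qed

lemma countable_union_interior:
  fixes C :: "nat \<Rightarrow> 'a::complete_space set"
  assumes "\<And>n. closed (C n)" "(\<Union>n. C n) = UNIV"
  obtains n where "interior (C n) \<noteq> {}"
proof (rule ccontr)
  assume "\<not> thesis"
  then have "interior (C n) = {}" for n using that by blast
  then have "euclidean interior_of (\<Union>(range C)) = {}"
    using assms(1)
    by (intro Baire_category_alt) (auto simp: completely_metrizable_space_euclidean interior_of_def interior_def)
  then show False using assms(2) by simp
qed

text \<open>
  The sets \<open>C n\<close> of perturbations that are feasible with all bounds equal to \<open>n\<close> are convex and, by
  weak compactness, closed. They cover a ball around \<open>0\<close>, so by Baire's theorem one of them has an
  interior point. A convex combination with a point in the opposite direction moves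
  the interior point to \<open>0\<close>.
\<close>
lemma perturbation_bounded_near_0:
  fixes f :: "'b::{real_inner, complete_space} \<Rightarrow> ereal"
    and g :: "'a::{real_inner, complete_space} \<Rightarrow> ereal"
  assumes g: "proper g" "convex_fun g" "lower_semicontinuous g"
    and f: "proper f" "convex_fun f" "lower_semicontinuous f"
    and L: "bounded_linear L" and reg: "regularity2 f g L"
  obtains \<rho> M where "\<rho> > 0"
    "\<And>y. norm y < \<rho> \<Longrightarrow> \<exists>x. g x \<le> ereal M \<and> f (L x + y) \<le> ereal M"
proof -
  interpret bounded_linear L by (rule L)
  define C where "C n = {y. \<exists>x. norm x \<le> real n \<and> g x \<le> ereal (real n) \<and> f (L x + y) \<le> ereal (real n)}"
    for n :: nat
  have C_mono: "C m \<subseteq> C n" if "m \<le> n" for m n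
  proof
    fix y assume "y \<in> C m"
    then obtain x where "norm x \<le> real m" "g x \<le> ereal (real m)" "f (L x + y) \<le> ereal (real m)"
      by (auto simp: C_def)
    moreover have "real m \<le> real n" "ereal (real m) \<le> ereal (real n)" using that by auto
    ultimately show "y \<in> C n" unfolding C_def by (blast intro: order_trans)
  qed
  have C_convex: "convex (C n)" for n
  proof (rule convexI)
    fix y z and s t :: real
    assume "y \<in> C n" "z \<in> C n" and st: "0 \<le> s" "0 \<le> t" "s + t = 1"
    then obtain x w where x: "norm x \<le> real n" "g x \<le> ereal (real n)" "f (L x + y) \<le> ereal (real n)"
      and w: "norm w \<le> real n" "g w \<le> ereal (real n)" "f (L w + z) \<le> ereal (real n)"
      by (auto simp: C_def)
    have s: "s = 1 - t" using st by simp
    have n: "(1 - t) * real n + t * real n = real n" by (simp add: algebra_simps)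
    have "norm ((1 - t) *\<^sub>R x + t *\<^sub>R w) \<le> (1 - t) * norm x + t * norm w"
      using st s by (intro norm_triangle_le) auto
    also have "\<dots> \<le> (1 - t) * real n + t * real n"
      using x(1) w(1) st s by (intro add_mono mult_left_mono) auto
    finally have 1: "norm ((1 - t) *\<^sub>R x + t *\<^sub>R w) \<le> real n" unfolding n .
    have 2: "g ((1 - t) *\<^sub>R x + t *\<^sub>R w) \<le> ereal (real n)"
      using convex_fun_le[OF g(2) x(2) w(2), of t] st n by simp
    have "L ((1 - t) *\<^sub>R x + t *\<^sub>R w) + ((1 - t) *\<^sub>R y + t *\<^sub>R z)
        = (1 - t) *\<^sub>R (L x + y) + t *\<^sub>R (L w + z)"
      by (simp add: add scaleR scaleR_add_right)
    then have 3: "f (L ((1 - t) *\<^sub>R x + t *\<^sub>R w) + ((1 - t) *\<^sub>R y + t *\<^sub>R z)) \<le> ereal (real n)"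
      using convex_fun_le[OF f(2) x(3) w(3), of t] st n by simp
    show "s *\<^sub>R y + t *\<^sub>R z \<in> C n"
      unfolding C_def s using 1 2 3 by blast
  qed
  have C_closed: "closed (C n)" for n
    unfolding closed_sequential_limits
  proof (intro allI impI, elim conjE)
    fix y l assume y: "\<forall>k. y k \<in> C n" and yl: "y \<longlonglongrightarrow> l"
    from y obtain x where x: "\<And>k. norm (x k) \<le> real n" "\<And>k. g (x k) \<le> ereal (real n)"
      "\<And>k. f (L (x k) + y k) \<le> ereal (real n)"
      unfolding C_def mem_Collect_eq by metis
    have "bounded (range x)" using x(1) by (auto simp: bounded_iff)
    then obtain r x0 where r: "strict_mono r" and x0: "weak_lim (\<lambda>k. x (r k)) x0"
      by (rule bounded_imp_weak_lim_subseq)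
    have "x0 \<bullet> x0 \<le> real n * norm x0"
    proof (rule LIMSEQ_le_const2[OF weak_limD[OF x0]])
      have "x (r k) \<bullet> x0 \<le> real n * norm x0" for k
        using norm_cauchy_schwarz[of "x (r k)" x0] mult_right_mono[OF x(1), of "norm x0" "r k"]
        by simp
      then show "\<exists>N. \<forall>k\<ge>N. x (r k) \<bullet> x0 \<le> real n * norm x0" by blast
    qed
    then have 1: "norm x0 \<le> real n"
      by (cases "x0 = 0") (auto simp: dot_square_norm power2_eq_square)
    have 2: "g x0 \<le> ereal (real n)" by (rule weak_lim_le[OF g x0]) (rule x(2))
    have "weak_lim (\<lambda>k. y (r k)) l"
      using weak_lim_subseq[OF tendsto_imp_weak_lim[OF yl] r] .
    then have "weak_lim (\<lambda>k. L (x (r k)) + y (r k)) (L x0 + l)"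
      by (intro weak_lim_add weak_lim_bounded_linear[OF L] x0)
    then have 3: "f (L x0 + l) \<le> ereal (real n)" by (rule weak_lim_le[OF f]) (rule x(3))
    show "l \<in> C n" unfolding C_def using 1 2 3 by blast
  qed
  obtain e where e: "e > 0"
    and dom: "\<And>z. norm z < e \<Longrightarrow> \<exists>x y. z = L x - y \<and> g x < \<infinity> \<and> f y < \<infinity>"
    using reg unfolding regularity2_def mem_interior by (auto simp: effective_domain_def subset_iff)
  have cover: "\<exists>n. y \<in> C n" if "norm y < e" for y
  proof -
    have "norm (- y) < e" using that by simp
    from dom[OF this] obtain x z where z: "- y = L x - z" "g x < \<infinity>" "f z < \<infinity>" by blast
    then have "z = L x + y" by (metis add_diff_cancel_left' diff_add_cancel minus_diff_eq)
    obtain s where s: "g x = ereal s" using z(2) g(1) by (cases "g x") (auto simp: proper_def)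
    obtain t where t: "f z = ereal t" using z(3) f(1) by (cases "f z") (auto simp: proper_def)
    obtain n :: nat where "max (norm x) (max s t) \<le> real n" using real_arch_simple by blast
    then show ?thesis using s t \<open>z = L x + y\<close> by (auto simp: C_def intro!: exI[of _ n] exI[of _ x])
  qed
  \<comment> \<open>Only a ball is covered by the sets \<open>C n\<close>; their dilations by all positive integers cover the space.\<close>
  define S where "S k = (\<lambda>y. inverse (real (Suc (fst (prod_decode k)))) *\<^sub>R y) -` C (snd (prod_decode k))"
    for k
  have "closed (S k)" for k
    unfolding S_def by (intro closed_vimage C_closed continuous_intros)
  moreover have "(\<Union>k. S k) = UNIV"
  proof -
    have "y \<in> (\<Union>k. S k)" for y
    proof -
      obtain m where m: "inverse (real (Suc m)) < e / (norm y + 1)"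
        using reals_Archimedean[of "e / (norm y + 1)"] e by (auto simp: add_nonneg_pos)
      have "norm (inverse (real (Suc m)) *\<^sub>R y) \<le> inverse (real (Suc m)) * (norm y + 1)"
        by (simp add: mult_left_mono)
      also have "\<dots> < e" using m by (simp add: pos_less_divide_eq add_nonneg_pos)
      finally obtain n where "inverse (real (Suc m)) *\<^sub>R y \<in> C n" using cover by blast
      then have "y \<in> S (prod_encode (m, n))" by (simp add: S_def)
      then show ?thesis by blast
    qed
    then show ?thesis by blast
  qed
  ultimately obtain k where "interior (S k) \<noteq> {}" by (rule countable_union_interior)
  then obtain y1 \<rho>1 where y1: "\<rho>1 > 0" "ball y1 \<rho>1 \<subseteq> S k"
    by (auto simp: mem_interior)
  define c where "c = inverse (real (Suc (fst (prod_decode k))))"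
  define n where "n = snd (prod_decode k)"
  have c: "c > 0" by (simp add: c_def)
  have inC: "c *\<^sub>R y1 + z \<in> C n" if "norm z < c * \<rho>1" for z
  proof -
    have "y1 + (1 / c) *\<^sub>R z \<in> ball y1 \<rho>1"
      using that c by (simp add: dist_norm pos_divide_less_eq mult.commute)
    then have "c *\<^sub>R (y1 + (1 / c) *\<^sub>R z) \<in> C n"
      using y1(2) by (auto simp: S_def c_def n_def)
    then show ?thesis using c by (simp add: scaleR_add_right)
  qed
  \<comment> \<open>Small enough for the reflected point to lie in the ball that is covered.\<close>
  define \<tau> where "\<tau> = e / (2 * (norm (c *\<^sub>R y1) + 1))"
  have \<tau>: "\<tau> > 0" using e by (simp add: \<tau>_def add_nonneg_pos)
  have "norm (- \<tau> *\<^sub>R (c *\<^sub>R y1)) \<le> \<tau> * (norm (c *\<^sub>R y1) + 1)"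
    using \<tau> c by (simp add: mult_left_mono)
  also have "\<dots> = e / 2"
  proof -
    have "e / (2 * B) * B = e / 2" if "B \<noteq> 0" for B using that by simp
    moreover have "norm (c *\<^sub>R y1) + 1 \<noteq> 0" using norm_ge_zero[of "c *\<^sub>R y1"] by linarith
    ultimately show ?thesis unfolding \<tau>_def .
  qed
  also have "\<dots> < e" using e by simp
  finally obtain m where m: "- \<tau> *\<^sub>R (c *\<^sub>R y1) \<in> C m" using cover by blast
  define N where "N = max m n"
  \<comment> \<open>The weight for which the centre \<open>c *\<^sub>R y1\<close> and its reflected multiple cancel.\<close>
  define \<theta> where "\<theta> = 1 / (1 + \<tau>)"
  have \<theta>: "0 < \<theta>" "\<theta> < 1" "\<theta> * \<tau> = 1 - \<theta>" using \<tau> by (auto simp: \<theta>_def field_simps)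
  show ?thesis
  proof (rule that[of "(1 - \<theta>) * (c * \<rho>1)" "real N"])
    show "0 < (1 - \<theta>) * (c * \<rho>1)" using \<theta> c y1(1) by simp
    fix y :: 'b assume y: "norm y < (1 - \<theta>) * (c * \<rho>1)"
    have "norm ((1 / (1 - \<theta>)) *\<^sub>R y) < c * \<rho>1"
      using y \<theta> by (simp add: pos_divide_less_eq mult.commute)
    then have A: "c *\<^sub>R y1 + (1 / (1 - \<theta>)) *\<^sub>R y \<in> C N"
      using inC C_mono[of n N] by (auto simp: N_def)
    have B: "- \<tau> *\<^sub>R (c *\<^sub>R y1) \<in> C N"
      using m C_mono[of m N] by (auto simp: N_def)
    have "\<theta> *\<^sub>R (- \<tau> *\<^sub>R (c *\<^sub>R y1)) + (1 - \<theta>) *\<^sub>R (c *\<^sub>R y1 + (1 / (1 - \<theta>)) *\<^sub>R y) \<in> C N"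
      using convexD[OF C_convex B A, of \<theta> "1 - \<theta>"] \<theta> by simp
    also have "\<theta> *\<^sub>R (- \<tau> *\<^sub>R (c *\<^sub>R y1)) = - ((1 - \<theta>) *\<^sub>R (c *\<^sub>R y1))"
      using \<theta>(3) by (simp flip: mult.assoc)
    finally have "y \<in> C N" using \<theta> by (simp add: scaleR_add_right)
    then show "\<exists>x. g x \<le> ereal (real N) \<and> f (L x + y) \<le> ereal (real N)"
      by (auto simp: C_def)
  qed
qed

text \<open>
  \<open>E\<close> plays the role of the epigraph of a convex function that is bounded by \<open>M\<close> near \<open>0\<close>. Such a
  function lies above the cone \<open>m - K |y|\<close>, so \<open>(0, m - \<epsilon>)\<close> is not in the closure of \<open>E\<close> and
  can be separated from it; since a whole neighbourhood of \<open>0\<close> belongs to the domain, the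
  separating hyperplane is not vertical.
\<close>
lemma convex_supporting_functional_approx:
  fixes E :: "('b::{real_inner, complete_space} \<times> real) set"
  assumes E: "convex E" and up: "\<And>y t t'. (y, t) \<in> E \<Longrightarrow> t \<le> t' \<Longrightarrow> (y, t') \<in> E"
    and low: "\<And>t. (0, t) \<in> E \<Longrightarrow> m \<le> t"
    and \<rho>: "\<rho> > 0" and M: "\<And>y. norm y \<le> \<rho> \<Longrightarrow> (y, M) \<in> E"
    and \<epsilon>: "\<epsilon> > 0"
  shows "\<exists>q. \<forall>y t. (y, t) \<in> E \<longrightarrow> m - \<epsilon> + q \<bullet> y \<le> t"
proof -
  have mM: "m \<le> M" using low M[of 0] \<rho> by simp
  define K where "K = (M - m) / \<rho>"
  \<comment> \<open>Write \<open>0\<close> as a convex combination of \<open>y\<close> and the opposite point of norm \<open>\<rho>\<close>, where the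
    bound \<open>M\<close> is available.\<close>
  have lip: "m - K * norm y \<le> t" if "(y, t) \<in> E" for y t
  proof (cases "y = 0")
    case True
    then show ?thesis using low that by simp
  next
    case False
    define \<theta> where "\<theta> = norm y / (norm y + \<rho>)"
    have pos: "norm y + \<rho> > 0" using \<rho> by (simp add: add_nonneg_pos)
    have \<theta>: "0 < \<theta>" "\<theta> < 1" "1 - \<theta> = \<rho> / (norm y + \<rho>)"
      using False \<rho> pos by (auto simp: \<theta>_def) (simp add: field_simps)
    have "(- (\<rho> / norm y) *\<^sub>R y, M) \<in> E" using M False \<rho> by simp
    then have inE: "(1 - \<theta>) *\<^sub>R (y, t) + \<theta> *\<^sub>R (- (\<rho> / norm y) *\<^sub>R y, M) \<in> E"
      by (rule convexD[OF E that]) (use \<theta>(1,2) in auto)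
    have "\<theta> * (\<rho> / norm y) = 1 - \<theta>"
      using False \<rho> by (simp add: \<theta>(3)) (simp add: \<theta>_def)
    then have "(1 - \<theta>) *\<^sub>R y + \<theta> *\<^sub>R (- (\<rho> / norm y) *\<^sub>R y) = 0"
      by (simp only: scaleR_minus_left scaleR_minus_right scaleR_scaleR add.right_inverse)
    then have "(1 - \<theta>) *\<^sub>R (y, t) + \<theta> *\<^sub>R (- (\<rho> / norm y) *\<^sub>R y, M) = (0, (1 - \<theta>) * t + \<theta> * M)"
      by (simp only: scaleR_Pair add_Pair real_scaleR_def)
    with inE have "(0, (1 - \<theta>) * t + \<theta> * M) \<in> E" by (simp only:)
    then have "m \<le> (1 - \<theta>) * t + \<theta> * M" by (rule low)
    then have "(norm y + \<rho>) * m \<le> (norm y + \<rho>) * ((1 - \<theta>) * t + \<theta> * M)"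
      using \<rho> by (intro mult_left_mono) auto
    also have "\<dots> = \<rho> * t + norm y * M"
    proof -
      show ?thesis using pos by (simp add: \<theta>(3) distrib_left) (simp add: \<theta>_def)
    qed
    finally show ?thesis using \<rho> by (simp add: K_def field_simps)
  qed
  have "closed {z :: 'b \<times> real. m - K * norm (fst z) \<le> snd z}"
    by (intro closed_Collect_le continuous_intros)
  then have clE: "closure E \<subseteq> {z. m - K * norm (fst z) \<le> snd z}"
    by (rule closure_minimal[rotated]) (use lip in auto)
  have "(0, M) \<in> E" using M \<rho> by simp
  then have "closure E \<noteq> {}" using closure_subset by blast
  then obtain z where zE: "z \<in> closure E"
    and z: "\<And>w. w \<in> closure E \<Longrightarrow> ((0, m - \<epsilon>) - z) \<bullet> (w - z) \<le> 0"
    using ex_nearest_point_variational[OF closed_closure convex_closure[OF E]] by metis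
  obtain y0 t0 where z0: "z = (y0, t0)" by fastforce
  define \<mu> where "\<mu> = t0 - (m - \<epsilon>)"
  have sep: "- (y0 \<bullet> (y - y0)) \<le> \<mu> * (t - t0)" if "(y, t) \<in> E" for y t
    using z[of "(y, t)"] that closure_subset[of E]
    by (auto simp: z0 inner_prod_def \<mu>_def algebra_simps)
  have \<mu>: "\<mu> > 0"
  proof (rule ccontr)
    assume "\<not> \<mu> > 0"
    have "(0, max M (t0 + 1)) \<in> E" using up[OF \<open>(0, M) \<in> E\<close>] by simp
    from sep[OF this] have "y0 \<bullet> y0 \<le> \<mu> * (max M (t0 + 1) - t0)" by simp
    also have "\<dots> \<le> 0" using \<open>\<not> \<mu> > 0\<close> by (intro mult_nonpos_nonneg) auto
    finally have "y0 = 0" by (metis inner_ge_zero inner_eq_zero_iff order_antisym)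
    then have "m \<le> t0" using clE zE z0 by auto
    then show False using \<open>\<not> \<mu> > 0\<close> \<epsilon> by (simp add: \<mu>_def)
  qed
  show ?thesis
  proof (intro exI[of _ "- (1 / \<mu>) *\<^sub>R y0"] allI impI)
    fix y t assume "(y, t) \<in> E"
    from sep[OF this] have "- (y0 \<bullet> y) + y0 \<bullet> y0 \<le> \<mu> * (t - t0)" by (simp add: inner_diff_right)
    then have "- (y0 \<bullet> y) \<le> \<mu> * (t - t0)" using inner_ge_zero[of y0] by linarith
    then have "- (y0 \<bullet> y) / \<mu> \<le> t - t0" using \<mu> by (subst pos_divide_le_eq) (auto simp: mult.commute)
    moreover have "m - \<epsilon> \<le> t0" using \<mu> by (simp add: \<mu>_def)
    ultimately show "m - \<epsilon> + (- (1 / \<mu>) *\<^sub>R y0) \<bullet> y \<le> t" by simp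
  qed
qed

text \<open>
  The approximate supporting functionals are uniformly bounded because of the bound \<open>M\<close> on a ball; a
  weak limit of them supports exactly.
\<close>
lemma convex_supporting_functional:
  fixes E :: "('b::{real_inner, complete_space} \<times> real) set"
  assumes E: "convex E" and up: "\<And>y t t'. (y, t) \<in> E \<Longrightarrow> t \<le> t' \<Longrightarrow> (y, t') \<in> E"
    and low: "\<And>t. (0, t) \<in> E \<Longrightarrow> m \<le> t"
    and \<rho>: "\<rho> > 0" and M: "\<And>y. norm y \<le> \<rho> \<Longrightarrow> (y, M) \<in> E"
  shows "\<exists>q. \<forall>y t. (y, t) \<in> E \<longrightarrow> m + q \<bullet> y \<le> t"
proof -
  have "\<exists>q. \<forall>y t. (y, t) \<in> E \<longrightarrow> m - inverse (real (Suc k)) + q \<bullet> y \<le> t" for k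
    by (rule convex_supporting_functional_approx[OF E _ _ \<rho>]) (use up low M in auto)
  then obtain q where q: "\<And>k y t. (y, t) \<in> E \<Longrightarrow> m - inverse (real (Suc k)) + q k \<bullet> y \<le> t"
    by metis
  have "norm (q k) \<le> (M - m + 1) / \<rho>" for k
  proof -
    have "m - inverse (real (Suc k)) + q k \<bullet> ((\<rho> / norm (q k)) *\<^sub>R q k) \<le> M"
      using \<rho> by (intro q M) simp
    moreover have "q k \<bullet> ((\<rho> / norm (q k)) *\<^sub>R q k) = \<rho> * norm (q k)"
      by (cases "q k = 0") (simp_all add: dot_square_norm power2_eq_square)
    moreover have "inverse (real (Suc k)) \<le> 1" by (simp add: inverse_le_1_iff)
    ultimately have "norm (q k) * \<rho> \<le> M - m + 1" by (simp add: mult.commute)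
    then show ?thesis using \<rho> by (simp add: pos_le_divide_eq)
  qed
  then have "bounded (range q)" by (auto simp: bounded_iff)
  then obtain r q0 where r: "strict_mono r" and q0: "weak_lim (\<lambda>k. q (r k)) q0"
    by (rule bounded_imp_weak_lim_subseq)
  show ?thesis
  proof (intro exI[of _ q0] allI impI)
    fix y t assume yt: "(y, t) \<in> E"
    have "(\<lambda>k. m - inverse (real (Suc (r k))) + q (r k) \<bullet> y) \<longlonglongrightarrow> m - 0 + q0 \<bullet> y"
      using LIMSEQ_subseq_LIMSEQ[OF LIMSEQ_inverse_real_of_nat r] weak_limD[OF q0]
      by (intro tendsto_add tendsto_diff tendsto_const) (auto simp: o_def)
    then show "m + q0 \<bullet> y \<le> t"
      using LIMSEQ_le_const2[of _ "m + q0 \<bullet> y" t] q[OF yt] by auto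
  qed
qed

text \<open>
  A supporting functional at \<open>0\<close> of the perturbation function \<open>y \<mapsto> inf\<^sub>x (g x + f (L x + y))\<close> is a
  multiplier: inserting \<open>x = u\<close> yields the subgradient inequality for \<open>f\<close>, and inserting
  \<open>y = L u - L x\<close> the one for \<open>g\<close>.
\<close>
lemma ex_KKT_multiplier:
  fixes f :: "'b::{real_inner, complete_space} \<Rightarrow> ereal"
    and g :: "'a::{real_inner, complete_space} \<Rightarrow> ereal"
  assumes g: "proper g" "convex_fun g" "lower_semicontinuous g"
    and f: "proper f" "convex_fun f" "lower_semicontinuous f"
    and L: "bounded_linear L" and reg: "regularity2 f g L"
    and u: "minimizer (primal_objective f g L) u"
  obtains p where "KKT_pair f g L u p"
proof -
  interpret bounded_linear L by (rule L)
  obtain \<rho> M where \<rho>: "\<rho> > 0"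
    and M: "\<And>y. norm y < \<rho> \<Longrightarrow> \<exists>x. g x \<le> ereal M \<and> f (L x + y) \<le> ereal M"
    using perturbation_bounded_near_0[OF g f L reg] by blast
  obtain x1 where x1: "g x1 \<le> ereal M" "f (L x1) \<le> ereal M" using M[of 0] \<rho> by auto
  have "g u + f (L u) \<le> g x1 + f (L x1)"
    using minimizer_le[OF u, of x1] by (simp add: primal_objective_def)
  also have "\<dots> \<le> ereal M + ereal M" using x1 by (intro add_mono)
  finally obtain a b where a: "g u = ereal a" and b: "f (L u) = ereal b"
    using g(1) f(1) by (cases "g u"; cases "f (L u)") (auto simp: proper_def)
  \<comment> \<open>The epigraph of the perturbation function, written with real bounds.\<close>
  define E where "E = {(y, t). \<exists>x s s'. g x \<le> ereal s \<and> f (L x + y) \<le> ereal s' \<and> s + s' \<le> t}"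
  have "convex E"
  proof (rule convexI)
    fix z w and \<sigma> \<tau> :: real
    assume "z \<in> E" "w \<in> E" and st: "0 \<le> \<sigma>" "0 \<le> \<tau>" "\<sigma> + \<tau> = 1"
    then obtain x s s' x' r r' where
      x: "g x \<le> ereal s" "f (L x + fst z) \<le> ereal s'" "s + s' \<le> snd z" and
      x': "g x' \<le> ereal r" "f (L x' + fst w) \<le> ereal r'" "r + r' \<le> snd w"
      by (auto simp: E_def)
    have \<sigma>: "\<sigma> = 1 - \<tau>" using st by simp
    have 1: "g (\<sigma> *\<^sub>R x + \<tau> *\<^sub>R x') \<le> ereal (\<sigma> * s + \<tau> * r)"
      using convex_fun_le[OF g(2) x(1) x'(1), of \<tau>] st \<sigma> by simp
    have "L (\<sigma> *\<^sub>R x + \<tau> *\<^sub>R x') + fst (\<sigma> *\<^sub>R z + \<tau> *\<^sub>R w)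
        = \<sigma> *\<^sub>R (L x + fst z) + \<tau> *\<^sub>R (L x' + fst w)"
      by (simp add: add scaleR scaleR_add_right)
    then have 2: "f (L (\<sigma> *\<^sub>R x + \<tau> *\<^sub>R x') + fst (\<sigma> *\<^sub>R z + \<tau> *\<^sub>R w)) \<le> ereal (\<sigma> * s' + \<tau> * r')"
      using convex_fun_le[OF f(2) x(2) x'(2), of \<tau>] st \<sigma> by simp
    have 3: "(\<sigma> * s + \<tau> * r) + (\<sigma> * s' + \<tau> * r') \<le> snd (\<sigma> *\<^sub>R z + \<tau> *\<^sub>R w)"
      using mult_left_mono[OF x(3) st(1)] mult_left_mono[OF x'(3) st(2)]
      by (simp add: algebra_simps)
    show "\<sigma> *\<^sub>R z + \<tau> *\<^sub>R w \<in> E"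
      unfolding E_def case_prod_beta using 1 2 3 by blast
  qed
  moreover have "(y, t') \<in> E" if "(y, t) \<in> E" "t \<le> t'" for y t t'
    using that unfolding E_def by fastforce
  moreover have "a + b \<le> t" if t: "(0, t) \<in> E" for t
  proof -
    obtain x s s' where x: "g x \<le> ereal s" "f (L x) \<le> ereal s'" "s + s' \<le> t"
      using t by (auto simp: E_def)
    have "ereal (a + b) \<le> g x + f (L x)"
      using minimizer_le[OF u, of x] a b by (simp add: primal_objective_def)
    also have "\<dots> \<le> ereal s + ereal s'" using x by (intro add_mono)
    finally show ?thesis using x(3) by simp
  qed
  moreover have "0 < \<rho> / 2" using \<rho> by simp
  moreover have "(y, M + M) \<in> E" if "norm y \<le> \<rho> / 2" for y
    using M[of y] that \<rho> by (force simp: E_def)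
  ultimately have "\<exists>q. \<forall>y t. (y, t) \<in> E \<longrightarrow> (a + b) + q \<bullet> y \<le> t"
    by (rule convex_supporting_functional)
  then obtain q where q: "\<And>y t. (y, t) \<in> E \<Longrightarrow> (a + b) + q \<bullet> y \<le> t" by blast
  have q': "(a + b) + q \<bullet> y \<le> s + s'" if "g x \<le> ereal s" "f (L x + y) \<le> ereal s'" for x y s s'
    using that by (intro q) (auto simp: E_def)
  have "q \<in> subdifferential f (L u)"
  proof (rule subdifferentialI[where F = f and r = b])
    fix y t assume "f y \<le> ereal t"
    then show "b + q \<bullet> (y - L u) \<le> t" using q'[of u a "y - L u" t] a by simp
  qed (use f(1) b in \<open>auto simp: proper_def\<close>)
  moreover have "- adjoint L q \<in> subdifferential g u"
  proof (rule subdifferentialI[where F = g and r = a])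
    fix x t assume "g x \<le> ereal t"
    then have "a + q \<bullet> (L u - L x) \<le> t" using q'[of x t "L u - L x" b] b by simp
    moreover have "(- adjoint L q) \<bullet> (x - u) = q \<bullet> (L u - L x)"
      by (simp add: inner_diff_right inner_adjoint_Hilbert[OF L])
    ultimately show "a + (- adjoint L q) \<bullet> (x - u) \<le> t" by simp
  qed (use g(1) a in \<open>auto simp: proper_def\<close>)
  ultimately show ?thesis using that by (simp add: KKT_pair_def)
qed

section \<open>Inexact Douglas-Rachford steps\<close>

text \<open>
  \<open>S\<close>, \<open>C\<close>, \<open>A\<close> are the differences of \<open>s\<^sup>k\<close>, \<open>c\<^sup>k\<close>, \<open>a\<close> to a limit candidate, \<open>\<delta>\<close> is the error
  \<open>d\<^sup>k - c\<^sup>k\<close>, and the two sign conditions express monotonicity. For \<open>\<delta> = \<epsilon> = 0\<close> the second one gives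
  \<open>|S + A|\<^sup>2 \<le> |S|\<^sup>2 + |C|\<^sup>2 - |C - A|\<^sup>2\<close> and the first one \<open>|S'|\<^sup>2 + |C'|\<^sup>2 \<le> |S' + C'|\<^sup>2\<close>. Half of
  \<open>|C - A|\<^sup>2\<close> is spent on absorbing the error term \<open>4 A \<bullet> \<delta>\<close>, in which \<open>A\<close> is not bounded by \<open>S\<close>
  and \<open>C\<close> alone.
\<close>
lemma Douglas_Rachford_step:
  fixes S C A \<delta> \<epsilon> S' C' :: "'a::real_inner"
  assumes mono': "0 \<le> S' \<bullet> C'" and step: "S' + C' = S + A + \<epsilon>"
    and mono: "A \<bullet> (S - C - 2 *\<^sub>R \<delta> + A) \<le> 0"
  shows "(norm (S', C'))\<^sup>2 + (norm (C - A))\<^sup>2 / 2 \<le> (norm (S, C) + (4 * norm \<delta> + norm \<epsilon>))\<^sup>2"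
proof -
  define N where "N = norm (S, C)"
  define R where "R = N + 4 * norm \<delta>"
  have N: "N\<^sup>2 = (norm S)\<^sup>2 + (norm C)\<^sup>2" "0 \<le> N" "norm C \<le> N"
    by (auto simp: N_def norm_Pair real_le_rsqrt)
  have "(norm (S + A))\<^sup>2 = (norm S)\<^sup>2 + (norm C)\<^sup>2 - (norm (C - A))\<^sup>2 + 4 * (A \<bullet> \<delta>)
      + 2 * (A \<bullet> (S - C - 2 *\<^sub>R \<delta> + A))"
    unfolding power2_norm_eq_inner by (simp add: algebra_simps inner_commute)
  also have "A \<bullet> \<delta> = C \<bullet> \<delta> - (C - A) \<bullet> \<delta>" by (simp add: inner_diff_left)
  finally have 1: "(norm (S + A))\<^sup>2 \<le> N\<^sup>2 - (norm (C - A))\<^sup>2 + 4 * (C \<bullet> \<delta>) - 4 * ((C - A) \<bullet> \<delta>)"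
    using mono N(1) by simp
  have 2: "C \<bullet> \<delta> \<le> N * norm \<delta>"
    using norm_cauchy_schwarz[of C \<delta>] mult_right_mono[OF N(3), of "norm \<delta>"] by simp
  have 3: "- ((C - A) \<bullet> \<delta>) \<le> norm (C - A) * norm \<delta>"
    using Cauchy_Schwarz_ineq2[of "C - A" \<delta>] by linarith
  have 4: "4 * (norm (C - A) * norm \<delta>) \<le> (norm (C - A))\<^sup>2 / 2 + 8 * (norm \<delta>)\<^sup>2"
    using zero_le_power2[of "norm (C - A) - 4 * norm \<delta>"] by (simp add: power2_diff power_mult_distrib)
  have "R\<^sup>2 = N\<^sup>2 + 8 * (N * norm \<delta>) + 16 * (norm \<delta>)\<^sup>2"
    by (simp add: R_def power2_sum power_mult_distrib)
  moreover have "0 \<le> N * norm \<delta>" using N(2) by simp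
  ultimately have SA: "(norm (S + A))\<^sup>2 + (norm (C - A))\<^sup>2 / 2 \<le> R\<^sup>2"
    using 1 2 3 4 zero_le_power2[of "norm \<delta>"] by linarith
  have "0 \<le> R" using N(2) by (simp add: R_def)
  then have "norm (S + A) \<le> R"
    by (rule power2_le_imp_le[rotated]) (use SA zero_le_power2[of "norm (C - A)"] in linarith)
  then have 5: "norm (S + A) * norm \<epsilon> \<le> R * norm \<epsilon>" by (rule mult_right_mono) simp
  have "(norm (S', C'))\<^sup>2 = (norm (S' + C'))\<^sup>2 - 2 * (S' \<bullet> C')"
    by (simp add: norm_Pair power2_norm_eq_inner algebra_simps inner_commute)
  also have "\<dots> \<le> (norm (S + A) + norm \<epsilon>)\<^sup>2"
    using mono' power_mono[OF norm_triangle_ineq[of "S + A" \<epsilon>] norm_ge_zero, of 2]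
    unfolding step by linarith
  finally have "(norm (S', C'))\<^sup>2 + (norm (C - A))\<^sup>2 / 2 \<le> (R + norm \<epsilon>)\<^sup>2"
    using SA 5 by (simp add: power2_sum)
  then show ?thesis by (simp add: R_def N_def add.assoc)
qed

text \<open>
  Subtracting the partial sums of \<open>\<eta>\<close> from \<open>N\<close> leaves a decreasing sequence. So \<open>N\<close> is bounded, and
  the squared inequality telescopes up to a multiple of \<open>\<eta>\<close>.
\<close>
lemma quasi_Fejer_convergence:
  fixes N w \<eta> :: "nat \<Rightarrow> real"
  assumes step: "\<And>n. (N (Suc n))\<^sup>2 + w n \<le> (N n + \<eta> n)\<^sup>2"
    and N: "\<And>n. 0 \<le> N n" and w: "\<And>n. 0 \<le> w n" and \<eta>: "\<And>n. 0 \<le> \<eta> n" "summable \<eta>"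
  shows "convergent N" "summable w"
proof -
  have Nstep: "N (Suc n) \<le> N n + \<eta> n" for n
    by (rule power2_le_imp_le) (use step[of n] w[of n] N[of n] \<eta>(1)[of n] in linarith)+
  define T where "T n = N n - sum \<eta> {..<n}" for n
  have sum_le: "sum \<eta> {..<n} \<le> suminf \<eta>" for n
    using \<eta> by (intro sum_le_suminf) auto
  have "decseq T"
    unfolding decseq_Suc_iff T_def using Nstep by (simp add: algebra_simps)
  moreover have "- suminf \<eta> \<le> T n" for n
    using sum_le[of n] N[of n] by (simp add: T_def)
  ultimately obtain l where "T \<longlonglongrightarrow> l" using decseq_convergent by metis
  then have "(\<lambda>n. T n + sum \<eta> {..<n}) \<longlonglongrightarrow> l + suminf \<eta>"
    using summable_LIMSEQ[OF \<eta>(2)] by (rule tendsto_add)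
  then show conv: "convergent N" by (auto simp: T_def convergent_def)
  obtain B where B: "\<And>n. N n \<le> B"
    using convergent_imp_Bseq[OF conv] N by (auto simp: Bseq_def)
  have wle: "w n \<le> (N n)\<^sup>2 - (N (Suc n))\<^sup>2 + (2 * B + suminf \<eta>) * \<eta> n" for n
  proof -
    have "\<eta> n \<le> suminf \<eta>"
      using sum_le_suminf[OF \<eta>(2), of "{n}"] \<eta>(1) by simp
    then have "\<eta> n * \<eta> n \<le> suminf \<eta> * \<eta> n" using \<eta>(1) by (rule mult_right_mono)
    moreover have "N n * \<eta> n \<le> B * \<eta> n" using B \<eta>(1) by (rule mult_right_mono)
    ultimately show ?thesis
      using step[of n] by (simp add: power2_sum power2_eq_square algebra_simps)
  qed
  have sum_w: "sum w {..<n} \<le> (N 0)\<^sup>2 - (N n)\<^sup>2 + (2 * B + suminf \<eta>) * sum \<eta> {..<n}" for n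
  proof (induction n)
    case (Suc n)
    then show ?case using wle[of n] by (simp add: distrib_left)
  qed simp
  have "sum w {..<n} \<le> (N 0)\<^sup>2 + (2 * B + suminf \<eta>) * suminf \<eta>" for n
  proof -
    have "0 \<le> 2 * B + suminf \<eta>"
      using B[of 0] N[of 0] suminf_nonneg[OF \<eta>(2)] \<eta>(1) by fastforce
    from mult_left_mono[OF sum_le[of n] this] sum_w[of n] zero_le_power2[of "N n"]
    show ?thesis by linarith
  qed
  then have "sum w {..n} \<le> (N 0)\<^sup>2 + (2 * B + suminf \<eta>) * suminf \<eta>" for n
    by (simp only: lessThan_Suc_atMost[symmetric])
  then show "summable w" using w by (intro bounded_imp_summable)
qed

lemma summable_norm_square:
  fixes x :: "nat \<Rightarrow> 'a::real_normed_vector"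
  assumes "summable (\<lambda>n. norm (x n))"
  shows "summable (\<lambda>n. (norm (x n))\<^sup>2)"
proof (rule summable_comparison_test_ev[OF _ assms])
  have "eventually (\<lambda>n. norm (x n) < 1) sequentially"
    using summable_LIMSEQ_zero[OF assms] by (rule order_tendstoD) simp
  then show "eventually (\<lambda>n. norm ((norm (x n))\<^sup>2) \<le> norm (x n)) sequentially"
  proof eventually_elim
    case (elim n)
    then show ?case using mult_left_le[of "norm (x n)" "norm (x n)"] by (simp add: power2_eq_square)
  qed
qed

section \<open>Weak limits of approximate optimality pairs\<close>

lemma tendsto_inner_bounded_null:
  fixes x y :: "nat \<Rightarrow> 'a::real_inner"
  assumes "x \<longlonglongrightarrow> 0" "bounded (range y)"
  shows "(\<lambda>n. x n \<bullet> y n) \<longlonglongrightarrow> 0"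
proof -
  obtain B where B: "\<And>n. norm (y n) \<le> B" using assms(2) by (auto simp: bounded_iff)
  have le: "norm (x n \<bullet> y n) \<le> norm (x n) * B" for n
    using Cauchy_Schwarz_ineq2[of "x n" "y n"] mult_left_mono[OF B, of "norm (x n)" n] by simp
  have "(\<lambda>n. norm (x n) * B) \<longlonglongrightarrow> 0"
    using tendsto_mult_right[OF tendsto_norm_zero[OF assms(1)], of B] by simp
  then show ?thesis by (rule Lim_null_comparison[OF always_eventually[OF allI[OF le]]])
qed

text \<open>
  Weak limits are harmless on the side of the conjugates, where only affine functions occur: bound
  \<open>g\<close>, \<open>f\<close> from below by subgradients at \<open>x n\<close>, \<open>y n\<close>, and their values there by affine minorants.
  All bilinear terms that remain either converge weakly or belong to the difference
  \<open>p n \<bullet> L (x n) - q n \<bullet> y n\<close>, which tends to \<open>0\<close>. Taking suprema over the four free points shows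
  that the two Fenchel-Young gaps at \<open>(q0, y0)\<close> have a sum that is at most \<open>0\<close>.
\<close>
lemma KKT_demiclosed:
  fixes f :: "'b::{real_inner, complete_space} \<Rightarrow> ereal"
    and g :: "'a::{real_inner, complete_space} \<Rightarrow> ereal"
  assumes g: "proper g" "convex_fun g" "lower_semicontinuous g"
    and f: "proper f" "convex_fun f" "lower_semicontinuous f"
    and L: "bounded_linear L"
    and chain: "subdifferential (\<lambda>c. conjugate g (- adjoint L c)) q0 \<subseteq>
                (\<lambda>v. - L v) ` subdifferential (conjugate g) (- adjoint L q0)"
    and px: "\<And>n. - adjoint L (p n) \<in> subdifferential g (x n)"
    and qy: "\<And>n. q n \<in> subdifferential f (y n)"
    and q0: "weak_lim q q0" "bounded (range q)" and y0: "weak_lim y y0" "bounded (range y)"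
    and pq: "(\<lambda>n. p n - q n) \<longlonglongrightarrow> 0" and xy: "(\<lambda>n. L (x n) - y n) \<longlonglongrightarrow> 0"
  obtains u where "L u = y0" "KKT_pair f g L u q0"
proof -
  note adj = inner_adjoint_Hilbert[OF L]
  have p0: "weak_lim p q0"
    using weak_lim_add[OF tendsto_imp_weak_lim[OF pq] q0(1)] by simp
  have Lx: "weak_lim (\<lambda>n. L (x n)) y0"
    using weak_lim_add[OF tendsto_imp_weak_lim[OF xy] y0(1)] by simp
  have gap: "(\<lambda>n. p n \<bullet> L (x n) - q n \<bullet> y n) \<longlonglongrightarrow> 0"
  proof -
    have "(\<lambda>n. (p n - q n) \<bullet> (L (x n) - y n) + (p n - q n) \<bullet> y n + (L (x n) - y n) \<bullet> q n)
        \<longlonglongrightarrow> 0 + 0 + 0"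
      by (intro tendsto_add tendsto_inner_bounded_null[OF pq y0(2)] tendsto_inner_bounded_null[OF xy q0(2)]
          tendsto_inner_bounded_null[OF pq convergent_imp_bounded[OF xy]])
    then show ?thesis by (simp add: inner_diff_left inner_diff_right inner_commute)
  qed
  have key: "q0 \<bullet> Y - q0 \<bullet> L X + w \<bullet> y0 - v \<bullet> y0 \<le> a + b + s + t"
    if gX: "g X \<le> ereal a" and fY: "f Y \<le> ereal b"
      and fw: "conjugate f w \<le> ereal s" and gv: "conjugate g (- adjoint L v) \<le> ereal t" for X Y v w a b s t
  proof -
    have "q n \<bullet> Y - p n \<bullet> L X + w \<bullet> y n - v \<bullet> L (x n) + (p n \<bullet> L (x n) - q n \<bullet> y n) \<le> a + b + s + t" for n
    proof -
      obtain \<gamma> where \<gamma>: "g (x n) = ereal \<gamma>" "\<gamma> + (- adjoint L (p n)) \<bullet> (X - x n) \<le> a"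
        using px[of n] by (rule subdifferentialE) (use gX in blast)
      obtain \<phi> where \<phi>: "f (y n) = ereal \<phi>" "\<phi> + q n \<bullet> (Y - y n) \<le> b"
        using qy[of n] by (rule subdifferentialE) (use fY in blast)
      have "w \<bullet> y n - s \<le> \<phi>" using conjugate_leD[OF fw] \<phi>(1) by simp
      moreover have "(- adjoint L v) \<bullet> x n - t \<le> \<gamma>" using conjugate_leD[OF gv] \<gamma>(1) by simp
      ultimately show ?thesis
        using \<gamma>(2) \<phi>(2) by (simp add: adj inner_diff_right)
    qed
    moreover have "(\<lambda>n. q n \<bullet> Y - p n \<bullet> L X + w \<bullet> y n - v \<bullet> L (x n) + (p n \<bullet> L (x n) - q n \<bullet> y n))
        \<longlonglongrightarrow> q0 \<bullet> Y - q0 \<bullet> L X + w \<bullet> y0 - v \<bullet> y0 + 0"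
      by (intro tendsto_add tendsto_diff gap weak_limD[OF q0(1)] weak_limD[OF p0]
          weak_limD'[OF y0(1)] weak_limD'[OF Lx])
    ultimately show ?thesis by (auto dest: LIMSEQ_le_const2)
  qed
  obtain X1 a1 where X1: "g X1 = ereal a1" using proper_obtain[OF g(1)] .
  obtain Y1 b1 where Y1: "f Y1 = ereal b1" using proper_obtain[OF f(1)] .
  obtain s1 where s1: "conjugate f (q 0) \<le> ereal s1"
    using qy[of 0] by (rule subdifferentialE) (use conjugate_le_of_subdifferential[OF f(1) qy] in blast)
  obtain t1 where t1: "conjugate g (- adjoint L (p 0)) \<le> ereal t1"
    using px[of 0] by (rule subdifferentialE) (use conjugate_le_of_subdifferential[OF g(1) px] in blast)
  \<comment> \<open>Supremum over \<open>X\<close> in \<open>key\<close>.\<close>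
  have H_le: "conjugate g (- adjoint L q0) \<le> ereal (b + s + t + v \<bullet> y0 - w \<bullet> y0 - q0 \<bullet> Y)"
    if "f Y \<le> ereal b" "conjugate f w \<le> ereal s" "conjugate g (- adjoint L v) \<le> ereal t"
    for Y v w b s t
  proof (rule conjugate_leI[OF g(1)])
    fix X a assume "g X \<le> ereal a"
    from key[OF this that]
    show "(- adjoint L q0) \<bullet> X - (b + s + t + v \<bullet> y0 - w \<bullet> y0 - q0 \<bullet> Y) \<le> a"
      by (simp add: adj)
  qed
  obtain H where H: "conjugate g (- adjoint L q0) = ereal H"
    using H_le[of Y1 b1, OF _ s1 t1] Y1 conjugate_not_MInf[OF g(1)]
    by (cases "conjugate g (- adjoint L q0)") auto
  \<comment> \<open>Supremum over \<open>Y\<close>.\<close>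
  have G_le: "conjugate f q0 \<le> ereal (s + t - H + v \<bullet> y0 - w \<bullet> y0)"
    if "conjugate f w \<le> ereal s" "conjugate g (- adjoint L v) \<le> ereal t" for v w s t
  proof (rule conjugate_leI[OF f(1)])
    fix Y b assume "f Y \<le> ereal b"
    from H_le[OF this that]
    show "q0 \<bullet> Y - (s + t - H + v \<bullet> y0 - w \<bullet> y0) \<le> b" by (simp add: H)
  qed
  obtain G where G: "conjugate f q0 = ereal G"
    using G_le[OF s1 t1] conjugate_not_MInf[OF f(1)] by (cases "conjugate f q0") auto
  have "- y0 \<in> subdifferential (\<lambda>c. conjugate g (- adjoint L c)) q0"
  proof (rule subdifferentialI[where r = H])
    fix v t assume "conjugate g (- adjoint L v) \<le> ereal t"
    with G_le[of q0 G v t] show "H + (- y0) \<bullet> (v - q0) \<le> t"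
      by (simp add: G inner_diff_right inner_commute)
  qed (use H conjugate_not_MInf[OF g(1)] in auto)
  with chain obtain u where u: "y0 = L u" "u \<in> subdifferential (conjugate g) (- adjoint L q0)"
    by auto
  have "y0 \<in> subdifferential (conjugate f) q0"
  proof (rule subdifferentialI[where r = G])
    fix w s assume "conjugate f w \<le> ereal s"
    with G_le[of w s q0 H] show "G + y0 \<bullet> (w - q0) \<le> s"
      by (simp add: G H inner_diff_right inner_commute)
  qed (use G conjugate_not_MInf[OF f(1)] in auto)
  then have "KKT_pair f g L u q0"
    using subdifferential_of_conjugate[OF f] subdifferential_of_conjugate[OF g u(2)] u(1)
    by (simp add: KKT_pair_def)
  with u(1) that show ?thesis by simp
qed

section \<open>Convergence of the alternating split Bregman algorithm\<close>

lemma asb_functional1_optimality: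
  fixes L :: "'a::{real_inner, complete_space} \<Rightarrow> 'b::real_inner"
  assumes "proper g" "convex_fun g" "bounded_linear L"
    and min: "minimizer (asb_functional1 g L lam b d) u"
  shows "- adjoint L (lam *\<^sub>R (b + L u - d)) \<in> subdifferential g u"
proof -
  have "asb_functional1 g L lam b d = (\<lambda>x. g x + ereal (lam / 2 * (norm ((b - d) + L x))\<^sup>2))"
    by (simp add: asb_functional1_def algebra_simps)
  with min have min': "minimizer (\<lambda>x. g x + ereal (lam / 2 * (norm ((b - d) + L x))\<^sup>2)) u" by simp
  obtain r where r: "g u = ereal r"
    and le: "\<And>y t. g y \<le> ereal t \<Longrightarrow> r - lam * (((b - d) + L u) \<bullet> L (y - u)) \<le> t"
    using minimizer_plus_quadratic[OF assms(1,2) bounded_linear.linear[OF assms(3)] min'] by blast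
  show ?thesis
  proof (rule subdifferentialI[where F = g and r = r])
    fix y t assume "g y \<le> ereal t"
    from le[OF this] show "r + (- adjoint L (lam *\<^sub>R (b + L u - d))) \<bullet> (y - u) \<le> t"
      by (simp add: inner_adjoint_Hilbert[OF assms(3)] linear_diff[OF bounded_linear.linear[OF assms(3)]]
          algebra_simps)
  qed (use assms(1) r in \<open>auto simp: proper_def\<close>)
qed

lemma asb_functional2_optimality:
  fixes f :: "'b::real_inner \<Rightarrow> ereal"
  assumes "proper f" "convex_fun f"
    and min: "minimizer (asb_functional2 f L lam b u) d"
  shows "lam *\<^sub>R (b + L u - d) \<in> subdifferential f d"
proof -
  have "asb_functional2 f L lam b u = (\<lambda>x. f x + ereal (lam / 2 * (norm ((b + L u) + - x))\<^sup>2))"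
    by (simp add: asb_functional2_def)
  with min have min': "minimizer (\<lambda>x. f x + ereal (lam / 2 * (norm ((b + L u) + - x))\<^sup>2)) d" by simp
  have "linear (uminus :: 'b \<Rightarrow> 'b)" by (rule linearI) auto
  from minimizer_plus_quadratic[OF assms(1,2) this min']
  obtain r where r: "f d = ereal r"
    and le: "\<And>y t. f y \<le> ereal t \<Longrightarrow> r - lam * (((b + L u) + - d) \<bullet> - (y - d)) \<le> t"
    by blast
  show ?thesis
  proof (rule subdifferentialI[where F = f and r = r])
    fix y t assume "f y \<le> ereal t"
    from le[OF this] show "r + (lam *\<^sub>R (b + L u - d)) \<bullet> (y - d) \<le> t"
      by (simp add: algebra_simps)
  qed (use assms(1) r in \<open>auto simp: proper_def\<close>)
qed

theorem theorem3p2: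
  fixes f :: "'b::{real_inner, complete_space} \<Rightarrow> ereal"
    and g :: "'a::{real_inner, complete_space} \<Rightarrow> ereal"
    and L :: "'a \<Rightarrow> 'b"
    and lam :: real
    and \<alpha> \<beta> :: "nat \<Rightarrow> real"
    and b0 d0 :: 'b
    and u :: "nat \<Rightarrow> 'a"
    and d b :: "nat \<Rightarrow> 'b"
  assumes "proper g" "convex_fun g" "lower_semicontinuous g"
    and "proper f" "convex_fun f" "lower_semicontinuous f"
    and "bounded_linear L"
    and "lam > 0"
    and "\<exists>v. minimizer (primal_objective f g L) v"
    and "\<exists>c. minimizer (dual_objective f g L) c"
    and "regularity1 f g L \<or> regularity2 f g L"
    and "\<And>c. subdifferential (\<lambda>c. conjugate g (- adjoint L c)) c =
               (\<lambda>v. - L v) ` subdifferential (conjugate g) (- adjoint L c)"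
    and "\<And>k. k \<ge> 1 \<Longrightarrow> \<alpha> k \<ge> 0 \<and> \<beta> k \<ge> 0"
    and "asb_well_defined f g L lam u d b"
    and "summable (\<lambda>k. \<alpha> (Suc k) + \<beta> (Suc k))"
    and "asb_generated f g L lam \<alpha> \<beta> b0 d0 u d b"
  shows "\<exists>dhat bhat.
           limitin weak_topology d dhat sequentially \<and>
           limitin weak_topology b bhat sequentially \<and>
           minimizer (dual_objective f g L) (lam *\<^sub>R bhat) \<and>
           (\<lambda>k. d k - L (u (Suc k))) \<longlonglongrightarrow> 0 \<and>
           summable (\<lambda>k. (norm (d k - L (u (Suc k))))\<^sup>2) \<and>
           (\<exists>uhat \<in> L -` {dhat}.
              minimizer (primal_objective f g L) uhat \<and>
              (inj L \<longrightarrow>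
                 (\<forall>v w. weak_cluster_point u v \<and> weak_cluster_point u w \<longrightarrow> v = w) \<and>
                 (\<forall>ubar. weak_cluster_point u ubar \<longrightarrow> ubar = uhat)))"
proof -
  note g = assms(1-3) and f = assms(4-6) and L = assms(7) and lam = assms(8)
  obtain uex dex where
    uex: "\<And>k. k \<ge> 1 \<Longrightarrow> minimizer (asb_functional1 g L lam (b (k - 1)) (d (k - 1))) (uex k)"
      "\<And>k. k \<ge> 1 \<Longrightarrow> norm (L (u k) - L (uex k)) \<le> \<alpha> k" and
    dex: "\<And>k. k \<ge> 1 \<Longrightarrow> minimizer (asb_functional2 f L lam (b (k - 1)) (u k)) (dex k)"
      "\<And>k. k \<ge> 1 \<Longrightarrow> norm (d k - dex k) \<le> \<beta> k" and
    b_step: "\<And>k. k \<ge> 1 \<Longrightarrow> b k = b (k - 1) + L (u k) - d k"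
    using assms(16) unfolding asb_generated_def by metis
  \<comment> \<open>The index \<open>n\<close> stands for iteration \<open>n + 1\<close>, the first one for which an exact minimizer \<open>dex\<close>
    exists; \<open>x n\<close> is the exact minimizer of the first step in the iteration after it. The pair
    \<open>(s, c)\<close> has the same sum as \<open>(b, d)\<close> but satisfies an exact optimality condition.\<close>
  define \<delta> where "\<delta> n = d (Suc n) - dex (Suc n)" for n
  define c where "c n = dex (Suc n)" for n
  define s where "s n = b (Suc n) + \<delta> n" for n
  define x where "x n = uex (Suc (Suc n))" for n
  define e where "e n = L (u (Suc (Suc n))) - L (x n)" for n
  define \<pi> where "\<pi> n = b (Suc n) + L (x n) - d (Suc n)" for n
  have d_eq: "d (Suc n) = c n + \<delta> n" for n by (simp add: c_def \<delta>_def)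
  have b_eq: "b (Suc n) = s n - \<delta> n" for n by (simp add: s_def)
  have \<pi>_eq: "\<pi> n = s n - c n - 2 *\<^sub>R \<delta> n + L (x n)" for n
    by (simp add: \<pi>_def d_eq b_eq scaleR_2 algebra_simps)
  have step: "s (Suc n) + c (Suc n) = s n + L (x n) + (e n - \<delta> n)" for n
    using b_step[of "Suc (Suc n)"] by (simp add: s_def \<delta>_def c_def e_def)
  have f_sub: "lam *\<^sub>R s n \<in> subdifferential f (c n)" for n
  proof -
    have "s n = b n + L (u (Suc n)) - dex (Suc n)"
      using b_step[of "Suc n"] by (simp add: s_def \<delta>_def)
    then show ?thesis
      using asb_functional2_optimality[OF f(1,2), of L lam "b n" "u (Suc n)" "dex (Suc n)"] dex(1)[of "Suc n"]
      by (simp add: c_def)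
  qed
  have g_sub: "- adjoint L (lam *\<^sub>R \<pi> n) \<in> subdifferential g (x n)" for n
    using asb_functional1_optimality[OF g(1,2) L uex(1)[of "Suc (Suc n)"]]
    by (simp add: \<pi>_def x_def)

  have "\<alpha> (Suc n) \<ge> 0" "\<beta> (Suc n) \<ge> 0" for n using assms(13)[of "Suc n"] by auto
  then have "summable (\<lambda>n. \<alpha> (Suc n))" and sum_\<beta>: "summable (\<lambda>n. \<beta> (Suc n))"
    by (auto intro: summable_comparison_test'[OF assms(15), of 0])
  then have sum_\<alpha>: "summable (\<lambda>n. \<alpha> (Suc (Suc n)))"
    by (simp only: summable_Suc_iff[of "\<lambda>n. \<alpha> (Suc n)"])
  have sum_\<delta>: "summable (\<lambda>n. norm (\<delta> n))"
    by (rule summable_comparison_test'[OF sum_\<beta>, of 0]) (use dex(2) in \<open>simp add: \<delta>_def\<close>)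
  have sum_e: "summable (\<lambda>n. norm (e n))"
    by (rule summable_comparison_test'[OF sum_\<alpha>, of 0]) (use uex(2) in \<open>simp add: e_def x_def\<close>)
  define \<eta> where "\<eta> n = 4 * norm (\<delta> n) + norm (e n - \<delta> n)" for n
  have \<eta>0: "0 \<le> \<eta> n" for n by (simp add: \<eta>_def)
  have "summable (\<lambda>n. norm (e n) + norm (\<delta> n))" using sum_e sum_\<delta> by (rule summable_add)
  then have "summable (\<lambda>n. norm (e n - \<delta> n))"
    by (rule summable_comparison_test'[of _ 0]) (auto intro: norm_triangle_ineq4)
  then have sum_\<eta>: "summable \<eta>"
    unfolding \<eta>_def by (intro summable_add summable_mult sum_\<delta>)

  define z where "z n = (s n, c n)" for n
  \<comment> \<open>The candidates for the weak limit of \<open>z\<close>.\<close>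
  define Sol where "Sol = {(inverse lam *\<^sub>R p, L v) | p v. KKT_pair f g L v p}"
  \<comment> \<open>Monotonicity of the subdifferentials of \<open>f\<close> and \<open>g\<close> provides the two sign conditions of the
    Douglas-Rachford step.\<close>
  have Fejer: "convergent (\<lambda>n. norm (z n - y))" "summable (\<lambda>n. (norm (c n - L (x n)))\<^sup>2 / 2)"
    if ySol: "y \<in> Sol" for y
  proof -
    obtain p v where y: "y = (inverse lam *\<^sub>R p, L v)" and
      p: "- adjoint L p \<in> subdifferential g v" "p \<in> subdifferential f (L v)"
      using ySol by (auto simp: Sol_def KKT_pair_def)
    define q where "q = inverse lam *\<^sub>R p"
    have pq: "p = lam *\<^sub>R q" using lam by (simp add: q_def)
    have mono_f: "0 \<le> (s n - q) \<bullet> (c n - L v)" for n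
      using subdifferential_monotone[OF f_sub p(2), of n] lam
      by (simp add: pq zero_le_mult_iff flip: scaleR_diff_right)
    have mono_g: "(L (x n) - L v) \<bullet> (\<pi> n - q) \<le> 0" for n
    proof -
      have "0 \<le> - ((lam *\<^sub>R (\<pi> n - q)) \<bullet> (L (x n) - L v))"
        using subdifferential_monotone[OF g_sub p(1), of n]
        by (simp add: pq inner_adjoint_Hilbert[OF L] algebra_simps)
      then show ?thesis using lam by (simp add: mult_le_0_iff inner_commute)
    qed
    have "(norm (z (Suc n) - y))\<^sup>2 + (norm (c n - L (x n)))\<^sup>2 / 2 \<le> (norm (z n - y) + \<eta> n)\<^sup>2" for n
    proof -
      have "(norm (s (Suc n) - q, c (Suc n) - L v))\<^sup>2 + (norm ((c n - L v) - (L (x n) - L v)))\<^sup>2 / 2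
          \<le> (norm (s n - q, c n - L v) + (4 * norm (\<delta> n) + norm (e n - \<delta> n)))\<^sup>2"
      proof (rule Douglas_Rachford_step)
        show "0 \<le> (s (Suc n) - q) \<bullet> (c (Suc n) - L v)" by (rule mono_f)
        show "(s (Suc n) - q) + (c (Suc n) - L v) = (s n - q) + (L (x n) - L v) + (e n - \<delta> n)"
          using step[of n] by (simp add: algebra_simps)
        have "(s n - q) - (c n - L v) - 2 *\<^sub>R \<delta> n + (L (x n) - L v) = \<pi> n - q"
          by (simp add: \<pi>_eq)
        then show "(L (x n) - L v) \<bullet> ((s n - q) - (c n - L v) - 2 *\<^sub>R \<delta> n + (L (x n) - L v)) \<le> 0"
          using mono_g[of n] by (simp only:)
      qed
      then show ?thesis by (simp add: z_def y q_def \<eta>_def)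
    qed
    from quasi_Fejer_convergence[OF this _ _ \<eta>0 sum_\<eta>]
    show "convergent (\<lambda>n. norm (z n - y))" "summable (\<lambda>n. (norm (c n - L (x n)))\<^sup>2 / 2)" by auto
  qed

  have reg: "regularity2 f g L" using assms(11) regularity1_imp_regularity2 by blast
  obtain v where "minimizer (primal_objective f g L) v" using assms(9) by blast
  from ex_KKT_multiplier[OF g f L reg this]
  obtain p where "KKT_pair f g L v p" by blast
  then have y1: "(inverse lam *\<^sub>R p, L v) \<in> Sol" by (auto simp: Sol_def)
  then have "Sol \<noteq> {}" by blast
  have sum_c: "summable (\<lambda>n. (norm (c n - L (x n)))\<^sup>2)"
    using summable_mult[OF Fejer(2)[OF y1], of 2] by simp
  have \<delta>_null: "\<delta> \<longlonglongrightarrow> 0"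
    using summable_LIMSEQ_zero[OF sum_\<delta>] by (rule tendsto_norm_zero_cancel)
  have c_null: "(\<lambda>n. L (x n) - c n) \<longlonglongrightarrow> 0"
    by (rule tendsto_norm_zero_cancel)
       (use tendsto_real_sqrt[OF summable_LIMSEQ_zero[OF sum_c]] in \<open>simp add: norm_minus_commute\<close>)
  have \<pi>_null: "(\<lambda>n. lam *\<^sub>R \<pi> n - lam *\<^sub>R s n) \<longlonglongrightarrow> 0"
  proof -
    have "(\<lambda>n. lam *\<^sub>R ((L (x n) - c n) - 2 *\<^sub>R \<delta> n)) \<longlonglongrightarrow> lam *\<^sub>R (0 - 2 *\<^sub>R 0)"
      by (intro tendsto_intros c_null \<delta>_null)
    then show ?thesis by (simp add: \<pi>_eq algebra_simps)
  qed
  obtain B where B: "\<And>n. norm (z n - (inverse lam *\<^sub>R p, L v)) \<le> B"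
    using convergent_imp_Bseq[OF Fejer(1)[OF y1]] by (auto simp: Bseq_def)
  have zB: "norm (z n) \<le> B + norm (inverse lam *\<^sub>R p, L v)" for n
    using norm_triangle_sub[of "z n" "(inverse lam *\<^sub>R p, L v)"] B[of n] by linarith
  have sB: "norm (s n) \<le> B + norm (inverse lam *\<^sub>R p, L v)" for n
    using zB[of n] norm_fst_le[of "s n" "c n"] by (simp add: z_def)
  have cB: "norm (c n) \<le> B + norm (inverse lam *\<^sub>R p, L v)" for n
    using zB[of n] norm_snd_le[of "c n" "s n"] by (simp add: z_def)
  \<comment> \<open>The differences \<open>\<pi> - s = (L x - c) - 2 \<delta>\<close> and \<open>L x - c\<close> tend to \<open>0\<close>, so weak cluster points are
    limit candidates.\<close>
  have clus: "l \<in> Sol" if r: "strict_mono r" and l: "weak_lim (\<lambda>n. z (r n)) l" for r l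
  proof -
    have ls: "weak_lim (\<lambda>n. s (r n)) (fst l)" and lc: "weak_lim (\<lambda>n. c (r n)) (snd l)"
      using l by (auto simp: weak_lim_Pair_iff z_def)
    have "norm (lam *\<^sub>R s n) \<le> \<bar>lam\<bar> * (B + norm (inverse lam *\<^sub>R p, L v))" for n
      using sB[of n] by (simp add: mult_left_mono)
    then have bs: "bounded (range (\<lambda>n. lam *\<^sub>R s (r n)))" by (auto simp: bounded_iff)
    have bc: "bounded (range (\<lambda>n. c (r n)))" using cB by (auto simp: bounded_iff)
    have "(\<lambda>n. lam *\<^sub>R \<pi> (r n) - lam *\<^sub>R s (r n)) \<longlonglongrightarrow> 0" "(\<lambda>n. L (x (r n)) - c (r n)) \<longlonglongrightarrow> 0"
      using LIMSEQ_subseq_LIMSEQ[OF \<pi>_null r] LIMSEQ_subseq_LIMSEQ[OF c_null r] by (simp_all add: o_def)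
    from KKT_demiclosed[OF g f L equalityD1[OF assms(12)] g_sub f_sub weak_lim_scaleR[OF ls] bs lc bc this]
    obtain w where "L w = snd l" "KKT_pair f g L w (lam *\<^sub>R fst l)" by blast
    moreover have "fst l = inverse lam *\<^sub>R (lam *\<^sub>R fst l)" using lam by simp
    ultimately show ?thesis unfolding Sol_def by (metis (mono_tags, lifting) mem_Collect_eq prod.collapse)
  qed
  have "\<exists>l. l \<in> Sol \<and> weak_lim z l"
    by (rule Opial_weak_lim[OF \<open>Sol \<noteq> {}\<close>, of z]) (use Fejer(1) clus in blast)+
  then obtain l where "l \<in> Sol" "weak_lim z l" by blast
  then obtain p' uhat where l: "l = (inverse lam *\<^sub>R p', L uhat)" "KKT_pair f g L uhat p'"
    by (auto simp: Sol_def)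
  define bhat where "bhat = inverse lam *\<^sub>R p'"
  define dhat where "dhat = L uhat"
  have p': "lam *\<^sub>R bhat = p'" using lam by (simp add: bhat_def)
  have ls: "weak_lim s bhat" and lc: "weak_lim c dhat"
    using \<open>weak_lim z l\<close> by (auto simp: weak_lim_Pair_iff z_def l(1) bhat_def dhat_def)
  have l\<delta>: "weak_lim (\<lambda>n. t *\<^sub>R \<delta> n) 0" for t
    using weak_lim_scaleR[OF tendsto_imp_weak_lim[OF \<delta>_null], of t] by simp
  have wd: "weak_lim d dhat"
    using weak_lim_add[OF lc l\<delta>[of 1]] weak_lim_Suc_iff[of d dhat] by (simp add: d_eq)
  have wb: "weak_lim b bhat"
    using weak_lim_add[OF ls l\<delta>[of "-1"]] weak_lim_Suc_iff[of b bhat] by (simp add: b_eq)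

  have "summable (\<lambda>n. (norm (d (Suc n) - L (u (Suc (Suc n)))))\<^sup>2)"
  proof (rule summable_comparison_test')
    have "summable (\<lambda>n. norm (norm (\<delta> n) + norm (e n)))"
      using summable_add[OF sum_\<delta> sum_e] by simp
    then have "summable (\<lambda>n. (norm (norm (\<delta> n) + norm (e n)))\<^sup>2)"
      by (rule summable_norm_square)
    then show "summable (\<lambda>n. 2 * (norm (c n - L (x n)))\<^sup>2 + 2 * (norm (\<delta> n) + norm (e n))\<^sup>2)"
      by (intro summable_add summable_mult sum_c) simp
    fix n
    have "d (Suc n) - L (u (Suc (Suc n))) = (c n - L (x n)) + (\<delta> n - e n)"
      by (simp add: d_eq e_def)
    then have "norm (d (Suc n) - L (u (Suc (Suc n)))) \<le> norm (c n - L (x n)) + (norm (\<delta> n) + norm (e n))"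
      using norm_triangle_ineq[of "c n - L (x n)" "\<delta> n - e n"] norm_triangle_ineq4[of "\<delta> n" "e n"]
      by simp
    then have "(norm (d (Suc n) - L (u (Suc (Suc n)))))\<^sup>2 \<le> (norm (c n - L (x n)) + (norm (\<delta> n) + norm (e n)))\<^sup>2"
      by (rule power_mono) simp
    also have "\<dots> \<le> 2 * (norm (c n - L (x n)))\<^sup>2 + 2 * (norm (\<delta> n) + norm (e n))\<^sup>2"
      using sum_squares_bound[of "norm (c n - L (x n))" "norm (\<delta> n) + norm (e n)"]
      by (simp add: power2_sum)
    finally show "norm ((norm (d (Suc n) - L (u (Suc (Suc n)))))\<^sup>2)
        \<le> 2 * (norm (c n - L (x n)))\<^sup>2 + 2 * (norm (\<delta> n) + norm (e n))\<^sup>2" by simp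
  qed
  then have sum_d: "summable (\<lambda>k. (norm (d k - L (u (Suc k))))\<^sup>2)"
    using summable_Suc_iff[of "\<lambda>k. (norm (d k - L (u (Suc k))))\<^sup>2"] by simp
  have d_null: "(\<lambda>k. d k - L (u (Suc k))) \<longlonglongrightarrow> 0"
    by (rule tendsto_norm_zero_cancel) (use tendsto_real_sqrt[OF summable_LIMSEQ_zero[OF sum_d]] in simp)

  \<comment> \<open>\<open>L (u k)\<close> converges weakly to \<open>dhat\<close>, since it differs from \<open>d (k - 1)\<close> by a null sequence.\<close>
  have cluster: "L ubar = dhat" if "weak_cluster_point u ubar" for ubar
  proof -
    have "(\<lambda>k. - (d k - L (u (Suc k)))) \<longlonglongrightarrow> - 0" using d_null by (rule tendsto_minus)
    from weak_lim_add[OF wd tendsto_imp_weak_lim[OF this]]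
    have "weak_lim (\<lambda>k. L (u k)) dhat" using weak_lim_Suc_iff[of "\<lambda>k. L (u k)" dhat] by simp
    then have "L ubar \<bullet> y = dhat \<bullet> y" for y
      using weak_cluster_point_tendsto[OF that bounded_linear_compose[OF bounded_linear_inner_left L], of y]
      by (simp add: weak_lim_def)
    then have "(L ubar - dhat) \<bullet> (L ubar - dhat) = 0" by (simp add: inner_diff_left)
    then show ?thesis by simp
  qed
  have "uhat \<in> L -` {dhat}" by (simp add: dhat_def)
  moreover have "inj L \<longrightarrow>
      (\<forall>v w. weak_cluster_point u v \<and> weak_cluster_point u w \<longrightarrow> v = w) \<and>
      (\<forall>ubar. weak_cluster_point u ubar \<longrightarrow> ubar = uhat)"
    using cluster by (metis dhat_def injD)
  moreover have "minimizer (primal_objective f g L) uhat"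
    by (rule KKT_imp_primal_minimizer[OF L g(1) f(1) l(2)])
  moreover have "minimizer (dual_objective f g L) (lam *\<^sub>R bhat)"
    unfolding p' by (rule KKT_imp_dual_minimizer[OF L g(1) f(1) l(2)])
  ultimately show ?thesis
    using limitin_weak_topology[OF wd] limitin_weak_topology[OF wb] d_null sum_d by blast
qed

end
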